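(* Suppose $\omega$ has the $\{0,1\}$-Bernoulli distribution $\mathbb{P}(\omega=0)=p$, $\mathbb{P}(\omega=1)=1-p$ for some $p\in(0,1)$. Then for any fixed $k>0$, $$\lim_{L\to\infty}\frac{\lambda_1}{\min\frac1u}=\frac{\pi^2}{8}$$ with probability one. And for any fixed positive integer $L$, $$\lim_{k\to\infty}\frac{\lambda_1}{\min\frac1u}=\frac{\pi^2}{8}$$ with probability $1-(1-p)^L$.
   Context: Let $\{\omega_j\}_{j\in\mathbb{Z}}$ be i.i.d. real random variables on a probability space, with $\omega$ denoting a random variable with their common distribution. Let $\chi$ be the characteristic function of $[0,1)$ and $V_\omega(x)=\sum_{j\in\mathbb{Z}}\omega_j\chi(x-j)$, $x\in\mathbb{R}$. For a positive integer $L$ and $k\ge 0$ let $H=-\Delta+kV_\omega$ on $\Omega=(0,L)$ with Dirichlet boundary conditions, where $\Delta=d^2/dx^2$. $\lambda_1$ denotes the smallest (ground state) eigenvalue of $H$ on $\Omega$. $u$ (the landscape function) denotes the unique solution of $Hu=1$ on $\Omega$ with $u(0)=u(L)=0$; it is strictly positive on $(0,L)$. $\min\frac1u$ is the minimum of $1/u$ over $\Omega$, i.e. $1/\max_{[0,L]}u$. Both $\lambda_1$ and $u$ depend on $L,k$ and $\omega$. Limits $L\to\infty$ are over positive integers, for a fixed realization of the whole sequence $(\omega_j)$. *)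

theory Defs
  imports "HOL-Probability.Probability"
begin

definition potential :: "(int \<Rightarrow> real) \<Rightarrow> real \<Rightarrow> real" where
  "potential w x = (\<Sum>\<^sub>\<infinity>j\<in>UNIV. w j * indicator {0..<1} (x - of_int j))"

text \<open>
  \<open>dirichlet_H2 l v g\<close>: the function \<open>v\<close> belongs to $H^2(0,l) \cap H^1_0(0,l)$ and has weak second
  derivative \<open>g\<close>. In one dimension this means that \<open>v\<close> is differentiable on the closed interval
  with derivative an indefinite integral of the square integrable function \<open>g\<close>, and that \<open>v\<close>
  vanishes at both end points. The potential jumps at integers, so a classical second derivative is
  not available there.
\<close>

definition dirichlet_H2 :: "real \<Rightarrow> (real \<Rightarrow> real) \<Rightarrow> (real \<Rightarrow> real) \<Rightarrow> bool" where
  "dirichlet_H2 l v g \<longleftrightarrow>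
     v 0 = 0 \<and> v l = 0 \<and>
     set_borel_measurable lborel {0..l} g \<and>
     set_integrable lborel {0..l} (\<lambda>t. (g t)\<^sup>2) \<and>
     (\<exists>v'. \<forall>x\<in>{0..l}.
        (v has_real_derivative v' x) (at x within {0..l}) \<and>
        v' x = v' 0 + (LINT t:{0..x}|lborel. g t))"

text \<open>\<open>dirichlet_solution q l v f\<close>: the function \<open>v\<close> lies in the domain of the Dirichlet operator
  $H = -d^2/dx^2 + q$ on $(0,l)$, and $Hv = f$. For bounded real \<open>q\<close> this operator is self-adjoint,
  so real eigenvalues and real eigenfunctions suffice below.\<close>

definition dirichlet_solution ::
    "(real \<Rightarrow> real) \<Rightarrow> real \<Rightarrow> (real \<Rightarrow> real) \<Rightarrow> (real \<Rightarrow> real) \<Rightarrow> bool" where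
  "dirichlet_solution q l v f \<longleftrightarrow>
     (\<exists>g. dirichlet_H2 l v g \<and>
          (AE x in lborel. x \<in> {0<..<l} \<longrightarrow> - g x + q x * v x = f x))"

definition dirichlet_eigenvalue :: "(real \<Rightarrow> real) \<Rightarrow> real \<Rightarrow> real \<Rightarrow> bool" where
  "dirichlet_eigenvalue q l \<mu> \<longleftrightarrow>
     (\<exists>v. dirichlet_solution q l v (\<lambda>x. \<mu> * v x) \<and> (\<exists>x\<in>{0<..<l}. v x \<noteq> 0))"

definition ground_eigenvalue :: "(real \<Rightarrow> real) \<Rightarrow> real \<Rightarrow> real" where
  "ground_eigenvalue q l = (LEAST \<mu>. dirichlet_eigenvalue q l \<mu>)"

text \<open>The landscape function is extended by zero, to make it unique as a function on all reals.\<close>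

definition landscape :: "(real \<Rightarrow> real) \<Rightarrow> real \<Rightarrow> real \<Rightarrow> real" where
  "landscape q l =
     (THE u. dirichlet_solution q l u (\<lambda>x. 1) \<and> (\<forall>x. x \<notin> {0..l} \<longrightarrow> u x = 0))"

definition min_inverse_landscape :: "(real \<Rightarrow> real) \<Rightarrow> real \<Rightarrow> real" where
  "min_inverse_landscape q l = (LEAST m. m \<in> (\<lambda>x. 1 / landscape q l x) ` {0<..<l})"

definition eigenvalue_landscape_ratio :: "(int \<Rightarrow> real) \<Rightarrow> real \<Rightarrow> nat \<Rightarrow> real" where
  "eigenvalue_landscape_ratio w k L =
     ground_eigenvalue (\<lambda>x. k * potential w x) (real L) /
     min_inverse_landscape (\<lambda>x. k * potential w x) (real L)"

end

theory Submission
  imports Defs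
begin

text \<open>
  On the cell \<open>[j, j + 1)\<close> the potential is the constant \<open>k * w j\<close>, which is \<open>0\<close> or \<open>k\<close>. Let \<open>l\<close> be
  the length of the longest run of zeros of \<open>w\<close> inside \<open>{0..<L}\<close>. If the walls of height \<open>k\<close> were
  impenetrable, the smallest eigenvalue would be $\pi^2/l^2$ and the maximum of the landscape
  function, attained in the middle of the longest run, would be $l^2/8$; the product is $\pi^2/8$.
  For walls of finite height, the eigenvalue is still at least $\pi^2/(l + C)^2$, and the maximum of the
  landscape function exceeds $l^2/8$ by at most \<open>2 / k + l * C / 4\<close>, where \<open>C = penetration k\<close> does not
  depend on the configuration. The resulting two-sided
  bound \<open>ratio_bounds\<close> is deterministic, and its two sides tend to $\pi^2/8$ both when \<open>l\<close> tends to
  infinity for a fixed \<open>k\<close> and when \<open>k\<close> tends to infinity for a fixed \<open>l > 0\<close> (then \<open>C\<close> tends to \<open>0\<close>).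

  The easy halves use the longest run directly. At the energy $\pi^2/l^2$ a solution changes its sign
  between the two ends of the run (\<open>ground_eigenvalue_le_of_well\<close>), and the landscape function lies
  above the parabola that vanishes at the two ends (\<open>landscape_ge_of_well\<close>). The hard halves
  compare with explicit positive supersolutions given cell by cell: a cosine (for the eigenvalue,
  \<open>shoot_pos_of_short_runs\<close>) or a parabola (for the landscape, \<open>landscape_le_of_short_runs\<close>) on each
  run of zeros, and a hyperbolic cosine on each wall cell. Concave kinks at the integers are allowed,
  since a concave kink is a positive point mass of the negative second derivative; the constant \<open>C\<close>
  comes from the condition that the kinks between runs and walls are concave. Both comparisons rest on
  one Sturm type propagation argument, \<open>cellwise_propagation\<close>.

  That the ground state eigenvalue exists at all is proved by shooting. For the solution that starts at
  \<open>0\<close> with slope \<open>1\<close>, the pairs (position, energy) at which it vanishes form a closed set; a pair of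
  least energy must sit at the right end of the interval, because a zero in the interior is simple and
  persists for slightly smaller energies (\<open>shoot_least_root\<close>).

  With probability one \<open>w\<close> contains runs of zeros of every length, which gives the first limit. For the
  second limit, a single zero among \<open>w 0, \<dots>, w (L - 1)\<close> suffices; without a zero the potential is
  constant and the ratio is at most \<open>1 + (pi / L)\<^sup>2 / k\<close>, whose limit \<open>1\<close> is smaller than $\pi^2/8$. So the
  event of convergence is, up to a null set, the complement of an event of probability \<open>(1 - p) ^ L\<close>.
\<close>

section \<open>Fundamental solutions of a constant coefficient equation\<close>

text \<open>
  \<open>ser 0 (z\<^sup>2) = cosh z\<close> and \<open>ser 1 (z\<^sup>2) = sinh z / z\<close>, with the trigonometric functions for negative
  arguments. Working with these entire functions avoids a case distinction on the sign of the
  coefficient of the differential equation and gives continuity in that coefficient for free.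
\<close>

definition ser :: "nat \<Rightarrow> real \<Rightarrow> real" where
  "ser m z = (\<Sum>n. z ^ n / fact (2 * n + m))"

lemma summable_ser: "summable (\<lambda>n. 1 / fact (2 * n + m) * (z::real) ^ n)"
proof (rule summable_comparison_test')
  show "summable (\<lambda>n. inverse (fact n) * \<bar>z\<bar> ^ n)" by (rule summable_exp)
  fix n :: nat
  have "(fact n :: real) \<le> fact (2 * n + m)" by (rule fact_mono) simp
  then have "1 / fact (2 * n + m) * \<bar>z\<bar> ^ n \<le> 1 / fact n * \<bar>z\<bar> ^ n"
    by (intro mult_right_mono divide_left_mono) auto
  then show "norm (1 / fact (2 * n + m) * z ^ n) \<le> inverse (fact n) * \<bar>z\<bar> ^ n"
    by (simp add: abs_mult power_abs divide_inverse)
qed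

lemma ser_at_0: "ser m 0 = 1 / fact m"
  using powser_zero[of "\<lambda>n. 1 / fact (2 * n + m) :: real"] by (simp add: ser_def)

lemma ser_0_eq: "ser 0 z = 1 + z * ser 2 z"
proof -
  have s: "summable (\<lambda>n. 1 / fact (2 * n + 0) * z ^ n)" by (rule summable_ser)
  have "(\<Sum>n. z * (1 / fact (2 * n + 2) * z ^ n)) = z * (\<Sum>n. 1 / fact (2 * n + 2) * z ^ n)"
    by (rule suminf_mult[OF summable_ser])
  moreover have "(\<Sum>n. 1 / fact (2 * Suc n + 0) * z ^ Suc n) = (\<Sum>n. 1 / fact (2 * n + 0) * z ^ n) - 1"
    using suminf_split_head[OF s] by simp
  moreover have "(\<lambda>n. 1 / fact (2 * Suc n + 0) * z ^ Suc n) = (\<lambda>n. z * (1 / fact (2 * n + 2) * z ^ n))"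
    by (rule ext) (simp add: mult_ac)
  ultimately show ?thesis by (simp add: ser_def)
qed

lemma DERIV_ser:
  obtains d where "(ser (Suc m) has_real_derivative d) (at z)"
    and "real (Suc m) * ser (Suc m) z + 2 * (z * d) = ser m z"
proof -
  let ?a = "\<lambda>n. 1 / fact (2 * n + Suc m) :: real"
  define d where "d = (\<Sum>n. diffs ?a n * z ^ n)"
  have D: "((\<lambda>x. \<Sum>n. ?a n * x ^ n) has_real_derivative d) (at z)"
    unfolding d_def by (rule termdiffs_strong_converges_everywhere) (rule summable_ser)
  have "summable (\<lambda>n. diffs ?a n * z ^ n)"
    by (rule termdiff_converges_all) (rule summable_ser)
  then have "(\<lambda>n. of_nat n * ?a n * z ^ (n - Suc 0)) sums d"
    unfolding d_def by (rule diffs_equiv)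
  then have "(\<lambda>n. z * (of_nat n * ?a n * z ^ (n - Suc 0))) sums (z * d)" by (rule sums_mult)
  moreover have "(\<lambda>n. z * (of_nat n * ?a n * z ^ (n - Suc 0))) = (\<lambda>n. of_nat n * ?a n * z ^ n)"
  proof
    fix n show "z * (of_nat n * ?a n * z ^ (n - Suc 0)) = of_nat n * ?a n * z ^ n"
      by (cases n) auto
  qed
  ultimately have "(\<lambda>n. of_nat n * ?a n * z ^ n) sums (z * d)" by simp
  then have "(\<lambda>n. real (Suc m) * (?a n * z ^ n) + 2 * (of_nat n * ?a n * z ^ n))
      sums (real (Suc m) * (\<Sum>n. ?a n * z ^ n) + 2 * (z * d))"
    by (intro sums_add sums_mult summable_sums summable_ser)
  moreover have "real (Suc m) * (?a n * z ^ n) + 2 * (of_nat n * ?a n * z ^ n) = 1 / fact (2 * n + m) * z ^ n"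
    for n
  proof -
    have "real (Suc m) * (?a n * z ^ n) + 2 * (of_nat n * ?a n * z ^ n)
        = (real (2 * n + Suc m) * ?a n) * z ^ n"
      unfolding of_nat_add of_nat_mult by (simp only: ring_distribs mult.assoc of_nat_numeral)
    also have "real (2 * n + Suc m) * ?a n = 1 / fact (2 * n + m)"
      by (simp add: field_simps del: of_nat_Suc)
    finally show ?thesis .
  qed
  ultimately have "(\<lambda>n. 1 / fact (2 * n + m) * z ^ n) sums (real (Suc m) * (\<Sum>n. ?a n * z ^ n) + 2 * (z * d))"
    by simp
  then have "(\<Sum>n. 1 / fact (2 * n + m) * z ^ n) = real (Suc m) * (\<Sum>n. ?a n * z ^ n) + 2 * (z * d)"
    by (simp add: sums_iff)
  with D that show thesis by (simp add: ser_def[abs_def])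
qed

lemma continuous_ser: "isCont (ser m) z"
proof -
  have "isCont (\<lambda>x. \<Sum>n. 1 / fact (2 * n + m) * x ^ n) z"
    by (rule isCont_powser_converges_everywhere) (rule summable_ser)
  then show ?thesis by (simp add: ser_def[abs_def])
qed

text \<open>
  The solutions of \<open>v'' = c * v\<close> with initial data \<open>(1, 0)\<close> and \<open>(0, 1)\<close> are \<open>fund 0 c\<close> and \<open>fund 1 c\<close>;
  \<open>fund 2 c\<close> solves \<open>v'' = c * v + 1\<close> with zero initial data.
\<close>

definition fund :: "nat \<Rightarrow> real \<Rightarrow> real \<Rightarrow> real" where
  "fund m c t = t ^ m * ser m (c * t\<^sup>2)"

lemma fund_at_0 [simp]: "fund 0 c 0 = 1" "fund (Suc m) c 0 = 0"
  by (simp_all add: fund_def ser_at_0)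

lemma fund_0_eq: "fund 0 c t = 1 + c * fund 2 c t"
  by (simp add: fund_def ser_0_eq[of "c * t\<^sup>2"])

lemma DERIV_fund_Suc: "(fund (Suc m) c has_real_derivative fund m c t) (at t)"
proof -
  obtain d where d: "(ser (Suc m) has_real_derivative d) (at (c * t\<^sup>2))"
    and e: "real (Suc m) * ser (Suc m) (c * t\<^sup>2) + 2 * (c * t\<^sup>2 * d) = ser m (c * t\<^sup>2)"
    by (rule DERIV_ser)
  have "((\<lambda>t. ser (Suc m) (c * t\<^sup>2)) has_real_derivative d * (c * (2 * t))) (at t)"
    by (rule DERIV_chain2[where f = "ser (Suc m)" and g = "\<lambda>t. c * t\<^sup>2"], rule d)
      (auto intro!: derivative_eq_intros)
  moreover have "((\<lambda>t. t ^ Suc m) has_real_derivative real (Suc m) * t ^ m) (at t)"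
    using DERIV_pow[of "Suc m" t UNIV] by simp
  ultimately have "((\<lambda>t. t ^ Suc m * ser (Suc m) (c * t\<^sup>2)) has_real_derivative
      (real (Suc m) * t ^ m) * ser (Suc m) (c * t\<^sup>2) + d * (c * (2 * t)) * t ^ Suc m) (at t)"
    by (intro DERIV_mult)
  also have "(real (Suc m) * t ^ m) * ser (Suc m) (c * t\<^sup>2) + d * (c * (2 * t)) * t ^ Suc m
     = t ^ m * (real (Suc m) * ser (Suc m) (c * t\<^sup>2) + 2 * (c * t\<^sup>2 * d))"
    by (simp add: algebra_simps power2_eq_square)
  finally show ?thesis by (simp only: e fund_def[abs_def])
qed

lemma DERIV_fund_0: "(fund 0 c has_real_derivative c * fund 1 c t) (at t)"
proof -
  have "((\<lambda>t. 1 + c * fund (Suc 1) c t) has_real_derivative c * fund 1 c t) (at t)"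
    by (auto intro!: derivative_eq_intros DERIV_fund_Suc)
  then show ?thesis by (simp add: fund_0_eq[abs_def] numeral_2_eq_2)
qed

lemma continuous_on_fund [continuous_intros]:
  assumes "continuous_on S f" "continuous_on S g"
  shows "continuous_on S (\<lambda>x. fund m (f x) (g x))"
proof -
  have "continuous_on UNIV (ser m)" using continuous_ser by (simp add: continuous_at_imp_continuous_on)
  moreover have "continuous_on S (\<lambda>x. f x * (g x)\<^sup>2)" by (intro continuous_intros assms)
  ultimately have "continuous_on S (\<lambda>x. ser m (f x * (g x)\<^sup>2))"
    by (rule continuous_on_compose2) simp
  then show ?thesis unfolding fund_def by (intro continuous_on_mult continuous_on_power assms)
qed

text \<open>
  The Wronskian of the two fundamental solutions is constant.
\<close>

lemma fund_det: "(fund 0 c t)\<^sup>2 - c * (fund 1 c t)\<^sup>2 = 1"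
proof -
  let ?W = "\<lambda>t. fund 0 c t * fund 0 c t - c * (fund 1 c t * fund 1 c t)"
  have D: "(?W has_real_derivative 0) (at x)" for x
  proof -
    have d0: "(fund 0 c has_real_derivative c * fund 1 c x) (at x)" by (rule DERIV_fund_0)
    have d1: "(fund 1 c has_real_derivative fund 0 c x) (at x)"
      unfolding One_nat_def by (rule DERIV_fund_Suc)
    have "(?W has_real_derivative
        (c * fund 1 c x * fund 0 c x + c * fund 1 c x * fund 0 c x)
        - c * (fund 0 c x * fund 1 c x + fund 0 c x * fund 1 c x)) (at x)"
      by (rule DERIV_diff[OF DERIV_mult[OF d0 d0] DERIV_cmult[OF DERIV_mult[OF d1 d1]]])
    then show ?thesis by (simp add: algebra_simps)
  qed
  have "?W t = ?W 0"
    by (rule DERIV_isconst_all[where f = ?W]) (use D in blast)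
  also have "\<dots> = 1" by (simp add: fund_def ser_at_0)
  finally show ?thesis by (simp add: power2_eq_square)
qed

section \<open>Solutions of a piecewise constant coefficient equation\<close>

text \<open>
  A continuously differentiable solution of \<open>v'' = c j * v - r\<close> on each closed cell \<open>[j, j + 1]\<close>, \<open>j < L\<close>.
  The one-sided second derivatives may differ at the integers, while \<open>v'\<close> is one function for all
  cells, so that it is continuous.
\<close>

definition cell_solution ::
    "(nat \<Rightarrow> real) \<Rightarrow> real \<Rightarrow> nat \<Rightarrow> (real \<Rightarrow> real) \<Rightarrow> (real \<Rightarrow> real) \<Rightarrow> bool" where
  "cell_solution c r L v v' \<longleftrightarrow>
     (\<forall>j<L. \<forall>x\<in>{real j..real j + 1}.
        (v has_real_derivative v' x) (at x within {real j..real j + 1}) \<and>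
        (v' has_real_derivative c j * v x - r) (at x within {real j..real j + 1}))"

lemma cell_solutionD:
  assumes "cell_solution c r L v v'" "j < L" "x \<in> {real j..real j + 1}"
  shows "(v has_real_derivative v' x) (at x within {real j..real j + 1})"
    and "(v' has_real_derivative c j * v x - r) (at x within {real j..real j + 1})"
  using assms by (auto simp: cell_solution_def)

lemma obtain_cell:
  assumes "0 \<le> x" "x < real L"
  obtains j where "j < L" "real j \<le> x" "x < real j + 1" "nat \<lfloor>x\<rfloor> = j"
proof
  show "nat \<lfloor>x\<rfloor> < L" "real (nat \<lfloor>x\<rfloor>) \<le> x" "x < real (nat \<lfloor>x\<rfloor>) + 1" "nat \<lfloor>x\<rfloor> = nat \<lfloor>x\<rfloor>"
    using assms by linarith+
qed

lemma obtain_closed_cell: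
  assumes "0 \<le> x" "x \<le> real L" "0 < L"
  obtains j where "j < L" "x \<in> {real j..real j + 1}"
proof (cases "x = real L")
  case True
  with assms have "L - 1 < L" "x \<in> {real (L - 1)..real (L - 1) + 1}" by auto
  then show thesis by (rule that)
next
  case False
  with assms obtain j where "j < L" "real j \<le> x" "x < real j + 1" by (meson obtain_cell order_less_le)
  then show thesis using that[of j] by simp
qed

lemma has_derivative_glue:
  fixes f :: "real \<Rightarrow> real"
  assumes "a \<le> m" "m \<le> b"
    and "x \<in> {a..m} \<Longrightarrow> (f has_real_derivative D) (at x within {a..m})"
    and "x \<in> {m..b} \<Longrightarrow> (f has_real_derivative D) (at x within {m..b})"
    and "x \<in> {a..b}"
  shows "(f has_real_derivative D) (at x within {a..b})"
proof -
  have piece: "(f has_real_derivative D) (at x within {u..w})"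
    if "x \<in> {u..w} \<Longrightarrow> (f has_real_derivative D) (at x within {u..w})" for u w
  proof (cases "x \<in> {u..w}")
    case False
    then have "at x within {u..w} = bot"
      using not_trivial_limit_within[of x "{u..w}"] by simp
    then have "((\<lambda>y. (f y - f x) / (y - x)) \<longlongrightarrow> D) (at x within {u..w})"
      by (simp only: tendsto_bot)
    then show ?thesis by (simp only: has_field_derivative_iff)
  qed (rule that)
  have "{a..b} = {a..m} \<union> {m..b}" using assms(1,2) by auto
  then have "at x within {a..b} = sup (at x within {a..m}) (at x within {m..b})"
    by (simp only: at_within_union)
  moreover have "((\<lambda>y. (f y - f x) / (y - x)) \<longlongrightarrow> D) (at x within {a..m})"
    "((\<lambda>y. (f y - f x) / (y - x)) \<longlongrightarrow> D) (at x within {m..b})"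
    using piece[OF assms(3)] piece[OF assms(4)] by (simp_all only: has_field_derivative_iff)
  ultimately have "((\<lambda>y. (f y - f x) / (y - x)) \<longlongrightarrow> D) (at x within {a..b})"
    by (simp only: filterlim_sup)
  then show ?thesis by (simp only: has_field_derivative_iff)
qed

lemma cellwise_derivative_glue:
  fixes f :: "real \<Rightarrow> real"
  assumes "m \<le> n"
    and "\<And>j. m \<le> j \<Longrightarrow> j < n \<Longrightarrow> x \<in> {real j..real j + 1} \<Longrightarrow>
      (f has_real_derivative D) (at x within {real j..real j + 1})"
    and "x \<in> {real m..real n}" and "m < n"
  shows "(f has_real_derivative D) (at x within {real m..real n})"
  using assms
proof (induction n)
  case 0 then show ?case by simp
next
  case (Suc n)
  have last: "(f has_real_derivative D) (at x within {real n..real (Suc n)})" if "x \<in> {real n..real (Suc n)}"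
    using Suc.prems(2)[of n] Suc.prems(4) that by (simp add: add.commute)
  show ?case
  proof (cases "m = n")
    case True then show ?thesis using last Suc.prems(3) by simp
  next
    case False
    with Suc.prems have "m < n" by simp
    show ?thesis
    proof (rule has_derivative_glue[where m = "real n"])
      show "real m \<le> real n" "real n \<le> real (Suc n)" "x \<in> {real m..real (Suc n)}" using \<open>m < n\<close> Suc.prems by auto
      show "(f has_real_derivative D) (at x within {real m..real n})" if "x \<in> {real m..real n}"
        using Suc.IH \<open>m < n\<close> Suc.prems(2) that by simp
    qed (rule last)
  qed
qed

lemma cell_solution_deriv:
  assumes "cell_solution c r L v v'" "m < n" "n \<le> L" "x \<in> {real m..real n}"
  shows "(v has_real_derivative v' x) (at x within {real m..real n})"
proof (rule cellwise_derivative_glue)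
  fix j assume "m \<le> j" "j < n" "x \<in> {real j..real j + 1}"
  then show "(v has_real_derivative v' x) (at x within {real j..real j + 1})"
    using cell_solutionD(1)[OF assms(1), of j x] assms(3) by auto
qed (use assms in auto)

text \<open>
  Across integers where the coefficient does not jump, the second derivative exists, too.
\<close>

lemma cell_solution_deriv2:
  assumes "cell_solution c r L v v'" "m < n" "n \<le> L" "x \<in> {real m..real n}"
    and "\<And>j. m \<le> j \<Longrightarrow> j < n \<Longrightarrow> c j = d"
  shows "(v' has_real_derivative d * v x - r) (at x within {real m..real n})"
proof (rule cellwise_derivative_glue)
  fix j assume j: "m \<le> j" "j < n" "x \<in> {real j..real j + 1}"
  then show "(v' has_real_derivative d * v x - r) (at x within {real j..real j + 1})"
    using cell_solutionD(2)[OF assms(1), of j x] assms(3,5) by auto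
qed (use assms in auto)

lemma cell_solution_continuous:
  assumes "cell_solution c r L v v'"
  shows "continuous_on {0..real L} v" "continuous_on {0..real L} v'"
proof -
  show "continuous_on {0..real L} v"
  proof (cases "L = 0")
    case False
    then show ?thesis using cell_solution_deriv[OF assms, of 0 L]
      by (intro DERIV_continuous_on[where D = v']) simp
  qed simp
  have "continuous_on {0..real n} v'" if "n \<le> L" for n
    using that
  proof (induction n)
    case (Suc n)
    have "continuous_on {real n..real n + 1} v'"
      using cell_solutionD(2)[OF assms, of n] Suc.prems
      by (intro DERIV_continuous_on[where D = "\<lambda>x. c n * v x - r"]) simp
    then have "continuous_on ({0..real n} \<union> {real n..real n + 1}) v'"
      using Suc by (intro continuous_on_closed_Un) auto
    moreover have "{0..real n} \<union> {real n..real n + 1} = {0..real (Suc n)}" by auto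
    ultimately show ?case by simp
  qed simp
  then show "continuous_on {0..real L} v'" by blast
qed

definition cellv :: "real \<Rightarrow> real \<Rightarrow> real \<Rightarrow> real \<Rightarrow> real \<Rightarrow> real" where
  "cellv c r a b t = a * fund 0 c t + b * fund 1 c t - r * fund 2 c t"

definition celld :: "real \<Rightarrow> real \<Rightarrow> real \<Rightarrow> real \<Rightarrow> real \<Rightarrow> real" where
  "celld c r a b t = a * (c * fund 1 c t) + b * fund 0 c t - r * fund 1 c t"

lemma DERIV_cellv: "(cellv c r a b has_real_derivative celld c r a b t) (at t)"
proof -
  have "(fund 1 c has_real_derivative fund 0 c t) (at t)" "(fund 2 c has_real_derivative fund 1 c t) (at t)"
    using DERIV_fund_Suc[of 0 c t] DERIV_fund_Suc[of 1 c t] by (simp_all add: numeral_2_eq_2)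
  then show ?thesis unfolding cellv_def[abs_def] celld_def
    by (intro DERIV_diff DERIV_add DERIV_cmult DERIV_fund_0)
qed

lemma DERIV_celld: "(celld c r a b has_real_derivative c * cellv c r a b t - r) (at t)"
proof -
  have "(fund 1 c has_real_derivative fund 0 c t) (at t)"
    using DERIV_fund_Suc[of 0 c t] by simp
  then have "(celld c r a b has_real_derivative a * (c * fund 0 c t) + b * (c * fund 1 c t) - r * fund 0 c t) (at t)"
    unfolding celld_def[abs_def]
    by (intro DERIV_diff DERIV_add DERIV_cmult DERIV_fund_0)
  also have "r * fund 0 c t = r + r * (c * fund 2 c t)" by (simp add: fund_0_eq algebra_simps)
  also have "a * (c * fund 0 c t) + b * (c * fund 1 c t) - (r + r * (c * fund 2 c t)) = c * cellv c r a b t - r"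
    by (simp add: cellv_def algebra_simps)
  finally show ?thesis .
qed

lemma cell_at_0 [simp]: "cellv c r a b 0 = a" "celld c r a b 0 = b"
  using fund_at_0(2)[of 0 c] fund_at_0(2)[of 1 c] by (simp_all add: cellv_def celld_def numeral_2_eq_2)

primrec traj_state :: "(nat \<Rightarrow> real) \<Rightarrow> real \<Rightarrow> real \<Rightarrow> real \<Rightarrow> nat \<Rightarrow> real \<times> real" where
  "traj_state c r a b 0 = (a, b)"
| "traj_state c r a b (Suc n) =
    (cellv (c n) r (fst (traj_state c r a b n)) (snd (traj_state c r a b n)) 1,
     celld (c n) r (fst (traj_state c r a b n)) (snd (traj_state c r a b n)) 1)"

text \<open>
  The solution with initial data \<open>(a, b)\<close> at \<open>0\<close>, defined for all cells at once: the data at the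
  integers are propagated by \<open>traj_state\<close>, and each cell is filled in from its left end.
\<close>

definition traj :: "(nat \<Rightarrow> real) \<Rightarrow> real \<Rightarrow> real \<Rightarrow> real \<Rightarrow> real \<Rightarrow> real" where
  "traj c r a b x = (let n = nat \<lfloor>x\<rfloor>; s = traj_state c r a b n in cellv (c n) r (fst s) (snd s) (x - n))"

definition traj' :: "(nat \<Rightarrow> real) \<Rightarrow> real \<Rightarrow> real \<Rightarrow> real \<Rightarrow> real \<Rightarrow> real" where
  "traj' c r a b x = (let n = nat \<lfloor>x\<rfloor>; s = traj_state c r a b n in celld (c n) r (fst s) (snd s) (x - n))"

lemma traj_on_cell:
  assumes "x \<in> {real n..real n + 1}"
  shows "traj c r a b x = cellv (c n) r (fst (traj_state c r a b n)) (snd (traj_state c r a b n)) (x - n)"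
    and "traj' c r a b x = celld (c n) r (fst (traj_state c r a b n)) (snd (traj_state c r a b n)) (x - n)"
proof -
  consider "nat \<lfloor>x\<rfloor> = n" | "x = real (Suc n)" "nat \<lfloor>x\<rfloor> = Suc n"
  proof -
    have "x = real n + 1 \<or> x < real n + 1" using assms by auto
    then show thesis
    proof
      assume "x < real n + 1" then have "nat \<lfloor>x\<rfloor> = n" using assms by simp linarith
      then show thesis by (rule that)
    next
      assume "x = real n + 1" then have "x = real (Suc n)" by simp
      moreover from this have "nat \<lfloor>x\<rfloor> = Suc n" by (metis floor_of_nat nat_int)
      ultimately show thesis by (rule that)
    qed
  qed
  then have "traj c r a b x = cellv (c n) r (fst (traj_state c r a b n)) (snd (traj_state c r a b n)) (x - n)
    \<and> traj' c r a b x = celld (c n) r (fst (traj_state c r a b n)) (snd (traj_state c r a b n)) (x - n)"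
    by cases (simp_all add: traj_def traj'_def Let_def)
  then show "traj c r a b x = cellv (c n) r (fst (traj_state c r a b n)) (snd (traj_state c r a b n)) (x - n)"
    "traj' c r a b x = celld (c n) r (fst (traj_state c r a b n)) (snd (traj_state c r a b n)) (x - n)"
    by blast+
qed

lemma traj_initial [simp]: "traj c r a b 0 = a" "traj' c r a b 0 = b"
  by (simp_all add: traj_def traj'_def)

lemma traj_cell_solution: "cell_solution c r L (traj c r a b) (traj' c r a b)"
  unfolding cell_solution_def
proof (intro allI impI ballI conjI)
  fix j x assume "x \<in> {real j..real j + 1}"
  define A B where "A = fst (traj_state c r a b j)" and "B = snd (traj_state c r a b j)"
  note eq = traj_on_cell[of _ j c r a b, folded A_def B_def]
  have sh: "((\<lambda>x. f (x - real j)) has_real_derivative d) (at x within {real j..real j + 1})"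
    if "(f has_real_derivative d) (at (x - real j))" for f d
    using DERIV_shift[of f d x "- real j"] that by (auto intro: has_field_derivative_at_within)
  have tr: "(f has_real_derivative d) (at x within {real j..real j + 1})"
    if "(g has_real_derivative d) (at x within {real j..real j + 1})"
      and "\<And>y. y \<in> {real j..real j + 1} \<Longrightarrow> g y = f y" for f g d
    using has_field_derivative_transform_within[OF that(1) zero_less_one \<open>x \<in> _\<close>] that(2) by blast
  show "(traj c r a b has_real_derivative traj' c r a b x) (at x within {real j..real j + 1})"
    unfolding eq(2)[OF \<open>x \<in> _\<close>]
    by (rule tr[OF sh[OF DERIV_cellv]]) (simp add: eq(1))
  show "(traj' c r a b has_real_derivative c j * traj c r a b x - r) (at x within {real j..real j + 1})"
    unfolding eq(1)[OF \<open>x \<in> _\<close>]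
    by (rule tr[OF sh[OF DERIV_celld]]) (simp add: eq(2))
qed

text \<open>
  Uniqueness for the initial value problem on a cell. The Wronskians of the difference \<open>d\<close> of two
  solutions with the two fundamental solutions are constant and vanish at the left end; since the
  fundamental matrix has determinant \<open>1\<close>, \<open>d\<close> and its derivative vanish as well.
\<close>

lemma cell_solution_cell_unique:
  assumes cs: "cell_solution c r L v v'" and j: "j < L" and x: "x \<in> {real j..real j + 1}"
  shows "v x = cellv (c j) r (v (real j)) (v' (real j)) (x - real j)"
    and "v' x = celld (c j) r (v (real j)) (v' (real j)) (x - real j)"
proof -
  let ?S = "{real j..real j + 1}"
  define d where "d t = v t - cellv (c j) r (v (real j)) (v' (real j)) (t - real j)" for t
  define d' where "d' t = v' t - celld (c j) r (v (real j)) (v' (real j)) (t - real j)" for t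
  have Dd: "(d has_real_derivative d' t) (at t within ?S)"
    and Dd': "(d' has_real_derivative c j * d t) (at t within ?S)" if "t \<in> ?S" for t
  proof -
    have s: "((\<lambda>x. f (x - real j)) has_real_derivative m) (at t within ?S)"
      if "(f has_real_derivative m) (at (t - real j))" for f m
      using DERIV_shift[of f m t "- real j"] that by (auto intro: has_field_derivative_at_within)
    show "(d has_real_derivative d' t) (at t within ?S)"
      unfolding d_def[abs_def] d'_def
      by (intro DERIV_diff cell_solutionD[OF cs j that] s[OF DERIV_cellv])
    have "(d' has_real_derivative (c j * v t - r) -
        (c j * cellv (c j) r (v (real j)) (v' (real j)) (t - real j) - r)) (at t within ?S)"
      unfolding d'_def[abs_def]
      by (intro DERIV_diff cell_solutionD[OF cs j that] s[OF DERIV_celld])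
    then show "(d' has_real_derivative c j * d t) (at t within ?S)"
      by (simp add: d_def algebra_simps)
  qed
  have F: "((\<lambda>x. fund 0 (c j) (x - real j)) has_real_derivative c j * fund 1 (c j) (t - real j)) (at t within ?S)"
    "((\<lambda>x. fund 1 (c j) (x - real j)) has_real_derivative fund 0 (c j) (t - real j)) (at t within ?S)" for t
    using DERIV_shift[of "fund 0 (c j)" _ t "- real j"] DERIV_shift[of "fund 1 (c j)" _ t "- real j"]
      DERIV_fund_0[of "c j" "t - real j"] DERIV_fund_Suc[of 0 "c j" "t - real j"]
    by (auto intro: has_field_derivative_at_within)
  let ?p = "\<lambda>t. d t * fund 0 (c j) (t - real j) - d' t * fund 1 (c j) (t - real j)"
  let ?q = "\<lambda>t. d' t * fund 0 (c j) (t - real j) - c j * (d t * fund 1 (c j) (t - real j))"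
  have "(?p has_real_derivative 0) (at t within ?S)" "(?q has_real_derivative 0) (at t within ?S)"
    if t: "t \<in> ?S" for t
  proof -
    have "(?p has_real_derivative
        (d' t * fund 0 (c j) (t - real j) + c j * fund 1 (c j) (t - real j) * d t)
        - (c j * d t * fund 1 (c j) (t - real j) + fund 0 (c j) (t - real j) * d' t)) (at t within ?S)"
      by (intro DERIV_diff DERIV_mult Dd Dd' F t)
    then show "(?p has_real_derivative 0) (at t within ?S)" by (simp add: algebra_simps)
    have "(?q has_real_derivative
        (c j * d t * fund 0 (c j) (t - real j) + c j * fund 1 (c j) (t - real j) * d' t)
        - c j * (d' t * fund 1 (c j) (t - real j) + fund 0 (c j) (t - real j) * d t)) (at t within ?S)"
      by (intro DERIV_diff DERIV_cmult DERIV_mult Dd Dd' F t)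
    then show "(?q has_real_derivative 0) (at t within ?S)" by (simp add: algebra_simps)
  qed
  then obtain P Q where PQ: "\<And>t. t \<in> ?S \<Longrightarrow> ?p t = P" "\<And>t. t \<in> ?S \<Longrightarrow> ?q t = Q"
    using has_field_derivative_zero_constant[of ?S ?p] has_field_derivative_zero_constant[of ?S ?q]
    by (metis (no_types, lifting) convex_real_interval(5))
  have "d (real j) = 0" "d' (real j) = 0" by (simp_all add: d_def d'_def)
  then have "P = 0" "Q = 0" using PQ[of "real j"] by auto
  with PQ x have p: "?p x = 0" and q: "?q x = 0" by auto
  let ?A = "fund 0 (c j) (x - real j)" and ?B = "fund 1 (c j) (x - real j)"
  have "d x * (?A\<^sup>2 - c j * ?B\<^sup>2) = ?p x * ?A + ?q x * ?B"
    by (simp add: algebra_simps power2_eq_square)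
  then have "d x = 0" unfolding fund_det p q by simp
  moreover have "d' x * (?A\<^sup>2 - c j * ?B\<^sup>2) = c j * ?B * ?p x + ?q x * ?A"
    by (simp add: algebra_simps power2_eq_square)
  then have "d' x = 0" unfolding fund_det p q by simp
  ultimately show "v x = cellv (c j) r (v (real j)) (v' (real j)) (x - real j)"
    "v' x = celld (c j) r (v (real j)) (v' (real j)) (x - real j)"
    by (simp_all add: d_def d'_def)
qed

lemma cell_solution_eq_traj:
  assumes cs: "cell_solution c r L v v'" and x: "x \<in> {0..real L}"
  shows "v x = traj c r (v 0) (v' 0) x"
proof -
  have st: "traj_state c r (v 0) (v' 0) n = (v (real n), v' (real n))" if "n \<le> L" for n
    using that
  proof (induction n)
    case (Suc n)
    then show ?case
      using cell_solution_cell_unique[OF cs, of n "real n + 1"] by (simp add: add.commute)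
  qed simp
  show ?thesis
  proof (cases "L = 0")
    case False
    then obtain j where "j < L" "x \<in> {real j..real j + 1}"
      using x obtain_closed_cell[of x L] by auto
    then show ?thesis
      using cell_solution_cell_unique[OF cs, of j x] st[of j] traj_on_cell[of x j] by simp
  qed (use x in auto)
qed

section \<open>Weak Dirichlet solutions are piecewise classical\<close>

lemma potential_eq: "potential w x = w \<lfloor>x\<rfloor>"
proof -
  have "potential w x = (\<Sum>\<^sub>\<infinity>j\<in>{\<lfloor>x\<rfloor>}. w j * indicator {0..<1} (x - of_int j))"
    unfolding potential_def
  proof (rule infsum_cong_neutral)
    fix j :: int assume "j \<in> UNIV - {\<lfloor>x\<rfloor>}"
    then have "x - of_int j \<notin> {0..<1}" by simp linarith
    then show "w j * indicator {0..<1} (x - of_int j) = 0" by simp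
  qed auto
  also have "\<dots> = w \<lfloor>x\<rfloor> * indicator {0..<1} (x - of_int \<lfloor>x\<rfloor>)"
    by (simp only: infsum_finite finite.emptyI finite.insertI sum.insert sum.empty empty_iff
      not_False_eq_True add_0_right)
  also have "x - of_int \<lfloor>x\<rfloor> \<in> {0..<1}" by simp linarith
  then have "indicator {0..<1} (x - of_int \<lfloor>x\<rfloor>) = (1 :: real)" by (rule indicator_simps)
  finally show ?thesis by simp
qed

text \<open>
  The weak equation only determines the second derivative \<open>g\<close> almost everywhere, but inside a cell the
  equation expresses \<open>g\<close> by the continuous function \<open>v\<close>. Hence \<open>v'\<close> is the integral of a continuous
  function there and is differentiable in the classical sense. The parameters \<open>\<mu>\<close> and \<open>r\<close> cover
  eigenfunctions (\<open>r = 0\<close>) and the landscape equation (\<open>\<mu> = 0\<close>, \<open>r = 1\<close>).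
\<close>

lemma cell_solution_of_dirichlet_solution:
  assumes sol: "dirichlet_solution q (real L) v f"
    and q: "\<And>x. 0 \<le> x \<Longrightarrow> x < real L \<Longrightarrow> q x = c (nat \<lfloor>x\<rfloor>)"
    and f: "\<And>x. f x = \<mu> * v x + r"
  obtains v' where "v 0 = 0" "v (real L) = 0" "cell_solution (\<lambda>j. c j - \<mu>) r L v v'"
proof -
  obtain g where H2: "dirichlet_H2 (real L) v g"
    and ae: "AE x in lborel. x \<in> {0<..<real L} \<longrightarrow> - g x + q x * v x = f x"
    using sol unfolding dirichlet_solution_def by blast
  have bd: "v 0 = 0" "v (real L) = 0"
    and meas: "set_borel_measurable lborel {0..real L} g"
    and sq: "set_integrable lborel {0..real L} (\<lambda>t. (g t)\<^sup>2)"
    using H2 unfolding dirichlet_H2_def by auto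
  obtain v' where D: "\<And>x. x \<in> {0..real L} \<Longrightarrow> (v has_real_derivative v' x) (at x within {0..real L})"
    and I: "\<And>x. x \<in> {0..real L} \<Longrightarrow> v' x = v' 0 + (LINT t:{0..x}|lborel. g t)"
    using H2 unfolding dirichlet_H2_def by blast
  have cont: "continuous_on {0..real L} v"
    by (rule DERIV_continuous_on[where D = v']) (rule D)
  have int: "set_integrable lborel {0..real L} g"
    unfolding set_integrable_def
  proof (rule Bochner_Integration.integrable_bound)
    have "set_integrable lborel {0..real L} (\<lambda>t. 1 + (g t)\<^sup>2)"
      by (intro set_integral_add sq) (simp add: set_integrable_def)
    then show "integrable lborel (\<lambda>t. indicat_real {0..real L} t *\<^sub>R (1 + (g t)\<^sup>2))"
      by (simp add: set_integrable_def)
    show "(\<lambda>t. indicat_real {0..real L} t *\<^sub>R g t) \<in> borel_measurable lborel"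
      using meas by (simp add: set_borel_measurable_def)
    have "\<bar>y\<bar> \<le> 1 + y\<^sup>2" for y :: real
      using zero_le_power2[of "\<bar>y\<bar> - 1/2"] by (simp add: power2_eq_square algebra_simps)
    then show "AE t in lborel. norm (indicat_real {0..real L} t *\<^sub>R g t)
        \<le> norm (indicat_real {0..real L} t *\<^sub>R (1 + (g t)\<^sup>2))"
      by (auto simp: abs_mult intro!: mult_left_mono AE_I2)
  qed
  have sub: "set_integrable lborel {a..b} g" if "0 \<le> a" "b \<le> real L" for a b
    by (rule set_integrable_subset[OF int]) (use that in auto)
  have HK: "(LINT t:{a..b}|lborel. g t) = integral {a..b} g" "g integrable_on {a..b}" if "0 \<le> a" "b \<le> real L" for a b
    using set_borel_integral_eq_integral[OF sub[OF that]] by auto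
  have "cell_solution (\<lambda>j. c j - \<mu>) r L v v'"
    unfolding cell_solution_def
  proof (intro allI impI ballI conjI)
    fix j x assume j: "j < L" and x: "x \<in> {real j..real j + 1}"
    have jL: "{real j..real j + 1} \<subseteq> {0..real L}" using j by auto
    show "(v has_real_derivative v' x) (at x within {real j..real j + 1})"
      by (rule has_field_derivative_subset[OF D jL]) (use x jL in auto)
    define h where "h t = (c j - \<mu>) * v t - r" for t
    have hc: "continuous_on {real j..real j + 1} h"
      unfolding h_def by (intro continuous_intros continuous_on_subset[OF cont jL])
    have eq: "v' y = v' (real j) + integral {real j..y} h" if y: "y \<in> {real j..real j + 1}" for y
    proof -
      have le: "0 \<le> real j" "real j \<le> y" "y \<le> real L" using y jL by auto
      have "v' y - v' (real j) = integral {0..y} g - integral {0..real j} g"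
        using I[of y] I[of "real j"] HK(1)[of 0 y] HK(1)[of 0 "real j"] le by auto
      also have "\<dots> = integral {real j..y} g"
        using Henstock_Kurzweil_Integration.integral_combine[OF le(1,2) HK(2)[of 0 y]] le by simp
      also have "\<dots> = (LINT t:{real j..y}|lborel. g t)" using HK(1)[of "real j" y] le by simp
      also have "\<dots> = (LINT t:{real j..y}|lborel. h t)"
        unfolding set_lebesgue_integral_def
      proof (rule integral_cong_AE)
        show "(\<lambda>t. indicat_real {real j..y} t *\<^sub>R g t) \<in> borel_measurable lborel"
          using sub[of "real j" y] le by (simp add: set_integrable_def)
        have "continuous_on {real j..y} h" by (rule continuous_on_subset[OF hc]) (use y in auto)
        then show "(\<lambda>t. indicat_real {real j..y} t *\<^sub>R h t) \<in> borel_measurable lborel"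
          using borel_measurable_continuous_on_indicator[of "{real j..y}" h] by simp
        have "AE t in lborel. t \<noteq> real j \<and> t \<noteq> real j + 1"
          using AE_lborel_singleton[of "real j"] AE_lborel_singleton[of "real j + 1"] by eventually_elim simp
        with ae show "AE t in lborel. indicat_real {real j..y} t *\<^sub>R g t = indicat_real {real j..y} t *\<^sub>R h t"
        proof eventually_elim
          case (elim t)
          show ?case
          proof (cases "t \<in> {real j..y}")
            case True
            with elim(2) y have t: "real j < t" "t < real j + 1" by auto
            then have "t \<in> {0<..<real L}" "nat \<lfloor>t\<rfloor> = j" using j by (auto, linarith+)
            with elim(1) q[of t] f[of t] have "g t = h t" by (simp add: h_def algebra_simps)
            then show ?thesis by simp
          qed simp
        qed
      qed
      also have "\<dots> = integral {real j..y} h"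
        by (rule set_borel_integral_eq_integral(2))
          (intro borel_integrable_atLeastAtMost' continuous_on_subset[OF hc], use y in auto)
      finally show ?thesis by simp
    qed
    have "((\<lambda>y. v' (real j) + integral {real j..y} h) has_real_derivative 0 + h x)
        (at x within {real j..real j + 1})"
      by (rule DERIV_add[OF DERIV_const integral_has_real_derivative[OF hc x]])
    then have "(v' has_real_derivative 0 + h x) (at x within {real j..real j + 1})"
      by (rule has_field_derivative_transform_within[OF _ zero_less_one x]) (rule eq[symmetric])
    then show "(v' has_real_derivative (c j - \<mu>) * v x - r) (at x within {real j..real j + 1})"
      by (simp add: h_def)
  qed
  show thesis by (rule that[of v']) fact+
qed

text \<open>
  Conversely, the fundamental theorem of calculus with finitely many exceptional points recovers \<open>v'\<close>
  from the second derivative, which is bounded and measurable.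
\<close>

lemma dirichlet_solution_of_cell_solution:
  assumes cs: "cell_solution (\<lambda>j. c j - \<mu>) r L v v'" and "0 < L"
    and bd: "v 0 = 0" "v (real L) = 0"
    and q: "\<And>x. 0 \<le> x \<Longrightarrow> x < real L \<Longrightarrow> q x = c (nat \<lfloor>x\<rfloor>)"
    and f: "\<And>x. f x = \<mu> * v x + r"
  shows "dirichlet_solution q (real L) v f"
proof -
  define g where "g x = (c (nat \<lfloor>x\<rfloor>) - \<mu>) * v x - r" for x
  note cont = cell_solution_continuous[OF cs]
  have meas: "set_borel_measurable lborel {0..real L} g"
  proof -
    have [measurable]: "(\<lambda>t. indicat_real {0..real L} t *\<^sub>R v t) \<in> borel_measurable borel"
      by (rule borel_measurable_continuous_on_indicator[OF _ cont(1)]) simp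
    have "(\<lambda>t. indicat_real {0..real L} t *\<^sub>R g t) =
      (\<lambda>t. (c (nat \<lfloor>t\<rfloor>) - \<mu>) * (indicat_real {0..real L} t *\<^sub>R v t) - r * indicat_real {0..real L} t)"
      by (auto simp: g_def algebra_simps)
    also have "\<dots> \<in> borel_measurable lborel" by measurable
    finally show ?thesis by (simp add: set_borel_measurable_def)
  qed
  obtain K where K: "\<And>x. x \<in> {0..real L} \<Longrightarrow> \<bar>g x\<bar> \<le> K"
  proof -
    obtain V where V: "\<And>x. x \<in> {0..real L} \<Longrightarrow> \<bar>v x\<bar> \<le> V"
      using compact_imp_bounded[OF compact_continuous_image[OF cont(1) compact_Icc]]
      unfolding bounded_iff by (metis imageI real_norm_def)
    have "\<bar>g x\<bar> \<le> (\<Sum>j\<le>L. \<bar>c j - \<mu>\<bar>) * V + \<bar>r\<bar>" if x: "x \<in> {0..real L}" for x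
    proof -
      have "nat \<lfloor>x\<rfloor> \<in> {..L}" using x by simp linarith
      then have "\<bar>c (nat \<lfloor>x\<rfloor>) - \<mu>\<bar> \<le> (\<Sum>j\<le>L. \<bar>c j - \<mu>\<bar>)"
        by (intro member_le_sum) auto
      then have "\<bar>(c (nat \<lfloor>x\<rfloor>) - \<mu>) * v x\<bar> \<le> (\<Sum>j\<le>L. \<bar>c j - \<mu>\<bar>) * V"
        using V[OF x] unfolding abs_mult by (intro mult_mono) auto
      then show ?thesis unfolding g_def by linarith
    qed
    then show thesis by (rule that)
  qed
  have sq: "set_integrable lborel {0..real L} (\<lambda>t. (g t)\<^sup>2)"
    unfolding set_integrable_def
  proof (rule Bochner_Integration.integrable_bound)
    show "integrable lborel (\<lambda>t. indicat_real {0..real L} t * K\<^sup>2)" by simp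
    have "(\<lambda>t. (indicat_real {0..real L} t *\<^sub>R g t)\<^sup>2) \<in> borel_measurable lborel"
      using meas unfolding set_borel_measurable_def by (rule borel_measurable_power)
    also have "(\<lambda>t. (indicat_real {0..real L} t *\<^sub>R g t)\<^sup>2) = (\<lambda>t. indicat_real {0..real L} t *\<^sub>R (g t)\<^sup>2)"
      by (auto simp: indicator_def)
    finally show "(\<lambda>t. indicat_real {0..real L} t *\<^sub>R (g t)\<^sup>2) \<in> borel_measurable lborel" .
    show "AE t in lborel. norm (indicat_real {0..real L} t *\<^sub>R (g t)\<^sup>2) \<le> norm (indicat_real {0..real L} t * K\<^sup>2)"
    proof (rule AE_I2)
      fix t show "norm (indicat_real {0..real L} t *\<^sub>R (g t)\<^sup>2) \<le> norm (indicat_real {0..real L} t * K\<^sup>2)"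
        using power_mono[OF K[of t], of 2] by (auto simp: indicator_def)
    qed
  qed
  have int: "set_integrable lborel {0..real L} g"
    unfolding set_integrable_def
  proof (rule Bochner_Integration.integrable_bound)
    show "integrable lborel (\<lambda>t. indicat_real {0..real L} t * K)" by simp
    show "(\<lambda>t. indicat_real {0..real L} t *\<^sub>R g t) \<in> borel_measurable lborel"
      using meas by (simp add: set_borel_measurable_def)
    show "AE t in lborel. norm (indicat_real {0..real L} t *\<^sub>R g t) \<le> norm (indicat_real {0..real L} t * K)"
    proof (rule AE_I2)
      fix t show "norm (indicat_real {0..real L} t *\<^sub>R g t) \<le> norm (indicat_real {0..real L} t * K)"
        using K[of t] by (auto simp: indicator_def)
    qed
  qed
  have I: "v' x = v' 0 + (LINT t:{0..x}|lborel. g t)" if x: "x \<in> {0..real L}" for x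
  proof -
    have "(g has_integral v' x - v' 0) {0..x}"
    proof (rule fundamental_theorem_of_calculus_interior_strong[where S = "real ` {..L}"])
      show "continuous_on {0..x} v'" by (rule continuous_on_subset[OF cont(2)]) (use x in auto)
      fix t assume t: "t \<in> {0<..<x} - real ` {..L}"
      then have "0 \<le> t" "t < real L" using x by auto
      then obtain j where j: "j < L" "real j \<le> t" "t < real j + 1" "nat \<lfloor>t\<rfloor> = j" by (rule obtain_cell)
      have "real j \<in> real ` {..L}" using j(1) by simp
      with t j(2) have "real j < t" by (metis DiffD2 order_less_le)
      then have "at t within {real j..real j + 1} = at t" using j by (intro at_within_Icc_at) auto
      then have "(v' has_real_derivative g t) (at t)"
        using cell_solutionD(2)[OF cs j(1), of t] j by (simp add: g_def)
      then show "(v' has_vector_derivative g t) (at t)"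
        by (simp add: has_real_derivative_iff_has_vector_derivative)
    qed (use x in auto)
    moreover have "set_integrable lborel {0..x} g"
      by (rule set_integrable_subset[OF int]) (use x in auto)
    ultimately show ?thesis
      using set_borel_integral_eq_integral(2)[of "{0..x}" g] by (simp add: integral_unique)
  qed
  have "dirichlet_H2 (real L) v g"
    unfolding dirichlet_H2_def
  proof (intro conjI bd meas sq exI[of _ v'] ballI)
    fix x assume x: "x \<in> {0..real L}"
    then show "(v has_real_derivative v' x) (at x within {0..real L})"
      using cell_solution_deriv[OF cs \<open>0 < L\<close> order_refl, of x] by simp
    from x show "v' x = v' 0 + (LINT t:{0..x}|lborel. g t)" by (rule I)
  qed
  moreover have "AE x in lborel. x \<in> {0<..<real L} \<longrightarrow> - g x + q x * v x = f x"
    by (rule AE_I2) (simp add: g_def q f algebra_simps)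
  ultimately show ?thesis unfolding dirichlet_solution_def by blast
qed

section \<open>Sturm comparison across the cells\<close>

text \<open>
  Sturm's comparison argument. Where \<open>v > 0\<close>, the Wronskian \<open>W = v' \<phi> - v \<phi>'\<close> is nondecreasing, and
  \<open>v / \<phi>\<close> has the derivative \<open>W / \<phi>\<^sup>2\<close>. So once \<open>v > 0\<close> and \<open>W \<ge> 0\<close> hold at a point, \<open>v / \<phi>\<close> cannot
  decrease any more and \<open>v\<close> stays positive. If \<open>v\<close> becomes positive inside the interval, the mean value
  theorem applied after the last zero of \<open>v\<close> provides such a point.
\<close>

lemma sturm_propagation:
  fixes v v' v'' \<phi> \<phi>' \<phi>'' :: "real \<Rightarrow> real"
  assumes dv: "\<And>x. x \<in> {a..b} \<Longrightarrow> (v has_real_derivative v' x) (at x within {a..b})"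
    and dv': "\<And>x. x \<in> {a..b} \<Longrightarrow> (v' has_real_derivative v'' x) (at x within {a..b})"
    and d\<phi>: "\<And>x. x \<in> {a..b} \<Longrightarrow> (\<phi> has_real_derivative \<phi>' x) (at x within {a..b})"
    and d\<phi>': "\<And>x. x \<in> {a..b} \<Longrightarrow> (\<phi>' has_real_derivative \<phi>'' x) (at x within {a..b})"
    and pos: "\<And>x. x \<in> {a..b} \<Longrightarrow> 0 < \<phi> x"
    and ineq: "\<And>x. x \<in> {a..b} \<Longrightarrow> 0 < v x \<Longrightarrow> v x * \<phi>'' x \<le> v'' x * \<phi> x"
    and start: "0 < v a \<Longrightarrow> v a * \<phi>' a \<le> v' a * \<phi> a"
    and x: "x \<in> {a..b}" "0 < v x"
    and t: "t \<in> {x..b}"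
  shows "0 < v t" "v t * \<phi>' t \<le> v' t * \<phi> t"
proof -
  define W where "W y = v' y * \<phi> y - v y * \<phi>' y" for y
  define f where "f y = v y / \<phi> y" for y
  have cv: "continuous_on {a..b} v" by (rule DERIV_continuous_on[OF dv])
  have cv': "continuous_on {a..b} v'" by (rule DERIV_continuous_on[OF dv'])
  have c\<phi>: "continuous_on {a..b} \<phi>" by (rule DERIV_continuous_on[OF d\<phi>])
  have c\<phi>': "continuous_on {a..b} \<phi>'" by (rule DERIV_continuous_on[OF d\<phi>'])
  have cW: "continuous_on {a..b} W" unfolding W_def by (intro continuous_intros cv cv' c\<phi> c\<phi>')
  have cf: "continuous_on {a..b} f" unfolding f_def
    by (intro continuous_intros cv c\<phi>) (use pos in force)
  have DW: "(W has_real_derivative v'' y * \<phi> y - v y * \<phi>'' y) (at y)"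
    and Df: "(f has_real_derivative W y / (\<phi> y * \<phi> y)) (at y)" if y: "a < y" "y < b" for y
  proof -
    have D: "(v has_real_derivative v' y) (at y)" "(v' has_real_derivative v'' y) (at y)"
      "(\<phi> has_real_derivative \<phi>' y) (at y)" "(\<phi>' has_real_derivative \<phi>'' y) (at y)" "0 < \<phi> y"
      using dv[of y] dv'[of y] d\<phi>[of y] d\<phi>'[of y] pos[of y] y by (simp_all add: at_within_Icc_at)
    have "(W has_real_derivative (v'' y * \<phi> y + \<phi>' y * v' y) - (v' y * \<phi>' y + \<phi>'' y * v y)) (at y)"
      unfolding W_def[abs_def] by (rule DERIV_diff[OF DERIV_mult[OF D(2,3)] DERIV_mult[OF D(1,4)]])
    then show "(W has_real_derivative v'' y * \<phi> y - v y * \<phi>'' y) (at y)" by (simp add: algebra_simps)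
    have "(f has_real_derivative (v' y * \<phi> y - v y * \<phi>' y) / (\<phi> y * \<phi> y)) (at y)"
      unfolding f_def[abs_def] by (rule DERIV_divide[OF D(1,3)]) (use D(5) in simp)
    then show "(f has_real_derivative W y / (\<phi> y * \<phi> y)) (at y)" by (simp add: W_def)
  qed
  have grow: "0 \<le> W d \<and> f c \<le> f d"
    if cd: "a \<le> c" "c \<le> d" "d \<le> b" and vp: "\<And>y. c < y \<Longrightarrow> y < d \<Longrightarrow> 0 < v y" and Wc: "0 \<le> W c" for c d
  proof -
    have W0: "0 \<le> W e" if "c \<le> e" "e \<le> d" for e
    proof -
      have "W c \<le> W e"
      proof (rule DERIV_nonneg_imp_increasing_open[where f = W])
        fix y assume y: "c < y" "y < e"
        then have "v y * \<phi>'' y \<le> v'' y * \<phi> y" using cd that vp[of y] by (intro ineq) auto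
        then show "\<exists>m. DERIV W y :> m \<and> 0 \<le> m" using DW[of y] y cd that by force
      qed (use cd that in \<open>auto intro: continuous_on_subset[OF cW]\<close>)
      with Wc show ?thesis by simp
    qed
    have "f c \<le> f d"
    proof (rule DERIV_nonneg_imp_increasing_open[where f = f])
      fix y assume y: "c < y" "y < d"
      then have "0 \<le> W y / (\<phi> y * \<phi> y)" using W0[of y] by simp
      then show "\<exists>m. DERIV f y :> m \<and> 0 \<le> m" using Df[of y] y cd by force
    qed (use cd in \<open>auto intro: continuous_on_subset[OF cf]\<close>)
    with W0[of d] cd show ?thesis by simp
  qed
  \<comment> \<open>The point from which \<open>v / \<phi>\<close> starts to grow.\<close>
  obtain c where c: "a \<le> c" "c \<le> x" "0 < v c" "0 \<le> W c"
  proof (cases "0 < v a")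
    case True
    then show thesis using that[of a] x start by (auto simp: W_def)
  next
    case False
    define Z where "Z = {a..x} \<inter> v -` {..0}"
    have "closed Z" unfolding Z_def
      by (intro continuous_closed_preimage continuous_on_subset[OF cv]) (use x in auto)
    moreover have "bounded Z" unfolding Z_def by (intro bounded_Int) auto
    ultimately have "compact Z" by (simp add: compact_eq_bounded_closed)
    moreover have "a \<in> Z" using False x by (auto simp: Z_def)
    ultimately obtain s where s: "s \<in> Z" "\<And>y. y \<in> Z \<Longrightarrow> y \<le> s"
      using compact_attains_sup[of Z] by auto
    have sx: "a \<le> s" "s < x" "v s \<le> 0" using s(1) x unfolding Z_def by (auto simp: order_less_le)
    have vp: "0 < v y" if "s < y" "y \<le> x" for y
      using s(2)[of y] that sx by (force simp: Z_def)
    obtain l z where z: "s < z" "z < x" "DERIV f z :> l" "f x - f s = (x - s) * l"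
    proof -
      have "continuous_on {s..x} f" by (rule continuous_on_subset[OF cf]) (use sx x in auto)
      moreover have "f differentiable (at y)" if "s < y" "y < x" for y
        using Df[of y] that sx x by (auto simp: real_differentiable_def)
      ultimately show thesis using MVT[of s x f] sx that by blast
    qed
    have "l = W z / (\<phi> z * \<phi> z)" using DERIV_unique[OF z(3) Df[of z]] z sx x by auto
    moreover have "0 < f x - f s"
      using divide_pos_pos[OF x(2) pos[OF x(1)]] divide_nonpos_pos[OF sx(3) pos[of s]] sx x
      by (simp add: f_def)
    then have "0 < l" using z(4) sx by (metis diff_gt_0_iff_gt zero_less_mult_pos)
    ultimately have "0 < W z" using pos[of z] z sx x by (simp add: zero_less_divide_iff mult_less_0_iff)
    with z sx vp[of z] show thesis by (intro that[of z]) auto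
  qed
  have vpos: "0 < v y" if y: "c \<le> y" "y \<le> b" for y
  proof (rule ccontr)
    assume "\<not> 0 < v y"
    define Z where "Z = {c..y} \<inter> v -` {..0}"
    have "closed Z" unfolding Z_def
      by (intro continuous_closed_preimage continuous_on_subset[OF cv]) (use c y in auto)
    moreover have "bounded Z" unfolding Z_def by (intro bounded_Int) auto
    ultimately have "compact Z" by (simp add: compact_eq_bounded_closed)
    moreover have "y \<in> Z" using \<open>\<not> 0 < v y\<close> y by (auto simp: Z_def)
    ultimately obtain s where s: "s \<in> Z" "\<And>y. y \<in> Z \<Longrightarrow> s \<le> y"
      using compact_attains_inf[of Z] by auto
    have sc: "c \<le> s" "s \<le> y" "v s \<le> 0" using s(1) unfolding Z_def by auto
    have "0 < v w" if "c < w" "w < s" for w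
      using s(2)[of w] that sc by (force simp: Z_def)
    then have "f c \<le> f s" using grow[of c s] c sc y by auto
    moreover have "0 < f c" using c pos[of c] x by (simp add: f_def)
    moreover have "f s \<le> 0" using sc pos[of s] c y by (simp add: f_def divide_nonpos_pos)
    ultimately show False by simp
  qed
  show "0 < v t" using vpos[of t] c t by auto
  have "0 \<le> W t" using grow[of c t] c t vpos by auto
  then show "v t * \<phi>' t \<le> v' t * \<phi> t" by (simp add: W_def)
qed

text \<open>
  The two functions are given separately on each cell. At an integer it suffices that \<open>v\<close> is continuous
  and that the condition \<open>W \<ge> 0\<close> carries over; the comparison function \<open>\<phi>\<close> need not be continuous, as
  only its logarithmic derivative matters.
\<close>

lemma cellwise_propagation:
  fixes v v' v'' \<phi> \<phi>' \<phi>'' :: "nat \<Rightarrow> real \<Rightarrow> real"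
  assumes dv: "\<And>j x. j < L \<Longrightarrow> x \<in> {real j..real j + 1} \<Longrightarrow>
      (v j has_real_derivative v' j x) (at x within {real j..real j + 1})"
    and dv': "\<And>j x. j < L \<Longrightarrow> x \<in> {real j..real j + 1} \<Longrightarrow>
      (v' j has_real_derivative v'' j x) (at x within {real j..real j + 1})"
    and d\<phi>: "\<And>j x. j < L \<Longrightarrow> x \<in> {real j..real j + 1} \<Longrightarrow>
      (\<phi> j has_real_derivative \<phi>' j x) (at x within {real j..real j + 1})"
    and d\<phi>': "\<And>j x. j < L \<Longrightarrow> x \<in> {real j..real j + 1} \<Longrightarrow>
      (\<phi>' j has_real_derivative \<phi>'' j x) (at x within {real j..real j + 1})"
    and pos: "\<And>j x. j < L \<Longrightarrow> x \<in> {real j..real j + 1} \<Longrightarrow> 0 < \<phi> j x"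
    and ineq: "\<And>j x. j < L \<Longrightarrow> x \<in> {real j..real j + 1} \<Longrightarrow> 0 < v j x \<Longrightarrow>
      v j x * \<phi>'' j x \<le> v'' j x * \<phi> j x"
    and start: "0 < v 0 0 \<Longrightarrow> v 0 0 * \<phi>' 0 0 \<le> v' 0 0 * \<phi> 0 0"
    and match: "\<And>j. Suc j < L \<Longrightarrow> v (Suc j) (real (Suc j)) = v j (real (Suc j))"
    and kink: "\<And>j. Suc j < L \<Longrightarrow> 0 < v j (real (Suc j)) \<Longrightarrow>
      v j (real (Suc j)) * \<phi>' j (real (Suc j)) \<le> v' j (real (Suc j)) * \<phi> j (real (Suc j)) \<Longrightarrow>
      v (Suc j) (real (Suc j)) * \<phi>' (Suc j) (real (Suc j)) \<le> v' (Suc j) (real (Suc j)) * \<phi> (Suc j) (real (Suc j))"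
    and i: "i < L" "x \<in> {real i..real i + 1}" "0 < v i x"
    and j: "i \<le> j" "j < L" "t \<in> {real j..real j + 1}" "x \<le> t"
  shows "0 < v j t"
proof -
  note local_step = sturm_propagation[OF dv dv' d\<phi> d\<phi>' pos ineq]
  have st: "v n (real n) * \<phi>' n (real n) \<le> v' n (real n) * \<phi> n (real n)" if "n < L" "0 < v n (real n)" for n
    using that
  proof (induction n)
    case 0 then show ?case using start by simp
  next
    case (Suc n)
    from Suc.prems match have p: "0 < v n (real (Suc n))" by simp
    have "v n (real (Suc n)) * \<phi>' n (real (Suc n)) \<le> v' n (real (Suc n)) * \<phi> n (real (Suc n))"
      using Suc.IH Suc.prems p by (intro local_step(2)[of n "real (Suc n)" "real (Suc n)"]) auto
    with kink p Suc.prems show ?case by simp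
  qed
  show ?thesis using j
  proof (induction j arbitrary: t rule: dec_induct)
    case base
    then show ?case using i st[of i] by (intro local_step(1)[of i x t]) auto
  next
    case (step n)
    have "0 < v n (real (Suc n))" using step.IH[of "real (Suc n)"] step.prems step.hyps i by auto
    then have "0 < v (Suc n) (real (Suc n))" using match step.prems by simp
    then show ?case using step.prems st[of "Suc n"]
      by (intro local_step(1)[of "Suc n" "real (Suc n)" t]) auto
  qed
qed

section \<open>The ground state eigenvalue by shooting\<close>

text \<open>
  The solution of \<open>v'' = (c j - \<mu>) * v\<close> with \<open>v 0 = 0\<close> and \<open>v' 0 = 1\<close>; its value at \<open>L\<close> vanishes
  exactly at the Dirichlet eigenvalues.
\<close>

abbreviation shoot :: "(nat \<Rightarrow> real) \<Rightarrow> real \<Rightarrow> real \<Rightarrow> real" where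
  "shoot c \<mu> \<equiv> traj (\<lambda>j. c j - \<mu>) 0 0 1"

abbreviation shoot' :: "(nat \<Rightarrow> real) \<Rightarrow> real \<Rightarrow> real \<Rightarrow> real" where
  "shoot' c \<mu> \<equiv> traj' (\<lambda>j. c j - \<mu>) 0 0 1"

lemma traj_scale:
  "traj c 0 0 b x = b * traj c 0 0 1 x"
proof -
  have lin: "cellv d 0 (b * A) (b * B) t = b * cellv d 0 A B t" "celld d 0 (b * A) (b * B) t = b * celld d 0 A B t" for d A B t
    by (simp_all add: cellv_def celld_def algebra_simps)
  have "fst (traj_state c 0 0 b n) = b * fst (traj_state c 0 0 1 n)
    \<and> snd (traj_state c 0 0 b n) = b * snd (traj_state c 0 0 1 n)" for n
    by (induction n) (simp_all add: lin)
  then show ?thesis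
    by (simp add: traj_def Let_def lin)
qed

text \<open>
  Joint continuity in energy and position: on each strip of one cell the solution is a fixed expression in
  the entire functions \<open>fund m\<close>, and the finitely many closed strips cover the domain.
\<close>

lemma continuous_on_shoot:
  "continuous_on ({0..real L} \<times> UNIV) (\<lambda>p. shoot c (snd p) (fst p))"
proof -
  have st: "continuous_on UNIV (\<lambda>\<mu>. fst (traj_state (\<lambda>j. c j - \<mu>) 0 0 1 n)) \<and>
    continuous_on UNIV (\<lambda>\<mu>. snd (traj_state (\<lambda>j. c j - \<mu>) 0 0 1 n))" for n
  proof (induction n)
    case (Suc n)
    then show ?case by (auto simp: cellv_def celld_def intro!: continuous_intros)
  qed simp
  show ?thesis
  proof (induction L)
    case 0
    have "continuous_on ({0} \<times> UNIV :: (real \<times> real) set) (\<lambda>p. 0 :: real)" by simp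
    then show ?case by (rule continuous_on_cong[THEN iffD1, rotated 2]) auto
  next
    case (Suc n)
    have pr: "continuous_on S (\<lambda>p. f (snd p))" if "continuous_on UNIV f" for S :: "(real \<times> real) set" and f :: "real \<Rightarrow> real"
      by (rule continuous_on_compose2[OF that]) (auto intro: continuous_intros)
    have "continuous_on ({real n..real n + 1} \<times> UNIV)
      (\<lambda>p. cellv (c n - snd p) 0 (fst (traj_state (\<lambda>j. c j - snd p) 0 0 1 n))
          (snd (traj_state (\<lambda>j. c j - snd p) 0 0 1 n)) (fst p - real n))"
      unfolding cellv_def
      by (intro continuous_intros pr[OF conjunct1[OF st]] pr[OF conjunct2[OF st]])
    then have "continuous_on ({real n..real n + 1} \<times> UNIV) (\<lambda>p. shoot c (snd p) (fst p))"
      by (rule continuous_on_cong[THEN iffD1, rotated 2]) (auto simp: traj_on_cell)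
    then have "continuous_on ({0..real n} \<times> UNIV \<union> {real n..real n + 1} \<times> UNIV) (\<lambda>p. shoot c (snd p) (fst p))"
      using Suc by (intro continuous_on_closed_Un closed_Times) auto
    moreover have "{0..real n} \<times> UNIV \<union> {real n..real n + 1} \<times> UNIV = {0..real (Suc n)} \<times> (UNIV :: real set)"
      by auto
    ultimately show ?case by simp
  qed
qed

lemma continuous_on_shoot_param:
  assumes "0 \<le> x" shows "continuous_on UNIV (\<lambda>\<mu>. shoot c \<mu> x)"
proof -
  obtain L where "x \<le> real L" using real_arch_simple by blast
  moreover have "continuous_on UNIV (\<lambda>\<mu>::real. (x, \<mu>))"
    by (intro continuous_on_Pair continuous_on_const continuous_on_id)
  ultimately show ?thesis
    using continuous_on_compose2[OF continuous_on_shoot[of L c], of UNIV "\<lambda>\<mu>. (x, \<mu>)"] assms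
    by (simp add: image_subset_iff)
qed

text \<open>
  All zeros of a nontrivial homogeneous solution are simple.
\<close>

lemma traj_nondegenerate:
  assumes "traj c 0 a b x = 0" "traj' c 0 a b x = 0" "0 \<le> x"
  shows "a = 0" "b = 0"
proof -
  have data_zero: "A = 0 \<and> B = 0" if "cellv d 0 A B t = 0" "celld d 0 A B t = 0" for d A B t
  proof -
    have "A * ((fund 0 d t)\<^sup>2 - d * (fund 1 d t)\<^sup>2) = fund 0 d t * cellv d 0 A B t - fund 1 d t * celld d 0 A B t"
      by (simp add: cellv_def celld_def power2_eq_square algebra_simps)
    moreover have "B * ((fund 0 d t)\<^sup>2 - d * (fund 1 d t)\<^sup>2) = fund 0 d t * celld d 0 A B t - d * fund 1 d t * cellv d 0 A B t"
      by (simp add: cellv_def celld_def power2_eq_square algebra_simps)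
    ultimately show ?thesis unfolding that fund_det by simp
  qed
  have down: "a = 0 \<and> b = 0" if "traj_state c 0 a b n = (0, 0)" for n
    using that
  proof (induction n)
    case (Suc n)
    then have "fst (traj_state c 0 a b n) = 0 \<and> snd (traj_state c 0 a b n) = 0" by (intro data_zero) auto
    then show ?case using Suc.IH by (simp add: prod_eq_iff)
  qed simp
  define n where "n = nat \<lfloor>x\<rfloor>"
  have "x \<in> {real n..real n + 1}" unfolding n_def using assms(3) by simp
  then have "fst (traj_state c 0 a b n) = 0 \<and> snd (traj_state c 0 a b n) = 0"
    using assms(1,2) by (intro data_zero) (simp_all add: traj_on_cell)
  then show "a = 0" "b = 0" using down[of n] by (auto simp: prod_eq_iff)
qed

text \<open>
  Near \<open>0\<close> the solution is \<open>x * ser 1 ((c 0 - \<mu>) * x\<^sup>2)\<close>, and the second factor is close to \<open>1\<close>. The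
  uniformity in \<open>\<mu>\<close> keeps the zero set used below away from the trivial zero at \<open>0\<close>.
\<close>

lemma shoot_pos_initially:
  obtains \<delta> where "0 < \<delta>" "\<delta> \<le> 1" "\<And>x \<mu>. 0 < x \<Longrightarrow> x \<le> \<delta> \<Longrightarrow> \<bar>\<mu>\<bar> \<le> m \<Longrightarrow> 0 < shoot c \<mu> x"
proof -
  have "isCont (ser 1) 0" by (rule continuous_ser)
  then have "\<exists>e>0. \<forall>z. dist z 0 < e \<longrightarrow> dist (ser 1 z) (ser 1 0) < 1"
    unfolding continuous_at_eps_delta using zero_less_one by blast
  then obtain e where e: "0 < e" "\<And>z. dist z 0 < e \<Longrightarrow> dist (ser 1 z) (ser 1 0) < 1" by blast
  have pos: "0 < ser 1 z" if "\<bar>z\<bar> < e" for z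
    using e(2)[of z] that by (simp add: ser_at_0 dist_real_def abs_less_iff)
  define K where "K = \<bar>c 0\<bar> + \<bar>m\<bar> + 1"
  define \<delta> where "\<delta> = min 1 (e / (2 * K))"
  have K: "0 < K" by (simp add: K_def)
  show thesis
  proof (rule that[of \<delta>])
    show "0 < \<delta>" "\<delta> \<le> 1" using e K by (auto simp: \<delta>_def)
    fix x \<mu> assume x: "0 < x" "x \<le> \<delta>" and \<mu>: "\<bar>\<mu>\<bar> \<le> m"
    have "\<bar>(c 0 - \<mu>) * x\<^sup>2\<bar> \<le> K * x\<^sup>2"
      using \<mu> by (auto simp: abs_mult K_def intro!: mult_right_mono)
    also have "\<dots> \<le> K * x" using x K \<open>\<delta> \<le> 1\<close> by (simp add: power2_eq_square mult_left_le)
    also have "\<dots> \<le> K * (e / (2 * K))" using x K by (intro mult_left_mono) (auto simp: \<delta>_def)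
    also have "\<dots> < e" using K e by simp
    finally have "0 < ser 1 ((c 0 - \<mu>) * x\<^sup>2)" by (rule pos)
    moreover have "shoot c \<mu> x = x * ser 1 ((c 0 - \<mu>) * x\<^sup>2)"
      using x \<open>\<delta> \<le> 1\<close> by (subst traj_on_cell[of x 0]) (simp_all add: cellv_def fund_def)
    ultimately show "0 < shoot c \<mu> x" using x by simp
  qed
qed

lemma traj_pos_of_nonneg:
  assumes c: "\<And>j. j < L \<Longrightarrow> 0 \<le> c j" and x: "0 < x" "x \<le> real L"
  shows "0 < traj c 0 0 1 x"
proof -
  obtain \<delta> where \<delta>: "0 < \<delta>" "\<delta> \<le> 1" "\<And>x \<mu>. 0 < x \<Longrightarrow> x \<le> \<delta> \<Longrightarrow> \<bar>\<mu>\<bar> \<le> 0 \<Longrightarrow> 0 < shoot c \<mu> x"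
    using shoot_pos_initially[of 0 c] by blast
  define s where "s = min \<delta> x"
  have s: "0 < s" "s \<le> x" "s \<le> 1" "0 < traj c 0 0 1 s"
    using \<delta>(1,2) \<delta>(3)[of s 0] x by (auto simp: s_def)
  have "0 < L" using x by (cases L) auto
  obtain j where j: "j < L" "x \<in> {real j..real j + 1}"
    using obtain_closed_cell[of x L] x \<open>0 < L\<close> by auto
  note cs = cell_solutionD[OF traj_cell_solution[of c 0 L 0 1]]
  show ?thesis
    by (rule cellwise_propagation[where i = 0 and x = s and j = j and t = x and L = L
        and v = "\<lambda>_. traj c 0 0 1" and v' = "\<lambda>_. traj' c 0 0 1" and v'' = "\<lambda>j x. c j * traj c 0 0 1 x - 0"
        and \<phi> = "\<lambda>_ _. 1" and \<phi>' = "\<lambda>_ _. 0" and \<phi>'' = "\<lambda>_ _. 0"])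
      (use cs j s c \<open>0 < L\<close> in auto)
qed

lemma dirichlet_eigenvalue_iff_shoot:
  assumes "0 < L" and q: "\<And>x. 0 \<le> x \<Longrightarrow> x < real L \<Longrightarrow> q x = c (nat \<lfloor>x\<rfloor>)"
  shows "dirichlet_eigenvalue q (real L) \<mu> \<longleftrightarrow> shoot c \<mu> (real L) = 0"
proof
  assume "dirichlet_eigenvalue q (real L) \<mu>"
  then obtain v where v: "dirichlet_solution q (real L) v (\<lambda>x. \<mu> * v x)" "\<exists>x\<in>{0<..<real L}. v x \<noteq> 0"
    unfolding dirichlet_eigenvalue_def by blast
  obtain v' where v': "v 0 = 0" "v (real L) = 0" "cell_solution (\<lambda>j. c j - \<mu>) 0 L v v'"
    by (rule cell_solution_of_dirichlet_solution[where c = c and \<mu> = \<mu> and r = 0, OF v(1) q]) simp_all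
  have eq: "v x = v' 0 * shoot c \<mu> x" if "x \<in> {0..real L}" for x
    using cell_solution_eq_traj[OF v'(3) that] v'(1) traj_scale[of _ "v' 0" x] by simp
  from v(2) obtain x where x: "x \<in> {0<..<real L}" "v x \<noteq> 0" by blast
  then have "v' 0 \<noteq> 0" using eq[of x] by auto
  then show "shoot c \<mu> (real L) = 0" using eq[of "real L"] v'(2) by simp
next
  assume z: "shoot c \<mu> (real L) = 0"
  have "dirichlet_solution q (real L) (shoot c \<mu>) (\<lambda>x. \<mu> * shoot c \<mu> x)"
    by (rule dirichlet_solution_of_cell_solution[where r = 0, OF traj_cell_solution])
      (use assms z in auto)
  moreover obtain \<delta> where \<delta>: "0 < \<delta>" "\<delta> \<le> 1" "\<And>x \<nu>. 0 < x \<Longrightarrow> x \<le> \<delta> \<Longrightarrow> \<bar>\<nu>\<bar> \<le> \<bar>\<mu>\<bar> \<Longrightarrow> 0 < shoot c \<nu> x"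
    using shoot_pos_initially[of "\<bar>\<mu>\<bar>" c] by blast
  have "0 < shoot c \<mu> (\<delta> / 2)" using \<delta>(1) by (intro \<delta>(3)) auto
  moreover have "\<delta> / 2 \<in> {0<..<real L}" using \<delta> \<open>0 < L\<close> by auto
  ultimately show "dirichlet_eigenvalue q (real L) \<mu>"
    unfolding dirichlet_eigenvalue_def by (metis less_irrefl)
qed

text \<open>
  If the solution for the energy \<open>m\<close> vanishes anywhere in the interval, then there is a least
  eigenvalue and it is at most \<open>m\<close>. Minimise the energy over the compact set of all pairs (position,
  energy) at which the solution vanishes. If the position of a minimiser were less than \<open>L\<close>, the
  solution would change its sign there, and by continuity in the energy it would do so for some smaller
  energy, too.
\<close>

lemma shoot_least_root:
  assumes c: "\<And>j. j < L \<Longrightarrow> 0 \<le> c j" and x0: "0 < x0" "x0 \<le> real L" and m: "shoot c m x0 = 0"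
  obtains \<mu>0 where "\<mu>0 \<le> m" "shoot c \<mu>0 (real L) = 0" "\<And>\<mu>. shoot c \<mu> (real L) = 0 \<Longrightarrow> \<mu>0 \<le> \<mu>"
proof -
  have L: "0 < L" using x0 by (cases L) auto
  have pos: "0 < \<mu>" if "shoot c \<mu> x = 0" "0 < x" "x \<le> real L" for \<mu> x
  proof (rule ccontr)
    assume "\<not> 0 < \<mu>"
    then have "0 \<le> c j - \<mu>" if "j < L" for j using c[OF that] by simp
    then have "0 < shoot c \<mu> x" using that by (intro traj_pos_of_nonneg[where L = L])
    with that show False by simp
  qed
  have "0 < m" using pos m x0 by blast
  obtain \<delta> where \<delta>: "0 < \<delta>" "\<delta> \<le> 1" "\<And>x \<mu>. 0 < x \<Longrightarrow> x \<le> \<delta> \<Longrightarrow> \<bar>\<mu>\<bar> \<le> m \<Longrightarrow> 0 < shoot c \<mu> x"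
    using shoot_pos_initially[of m c] by blast
  \<comment> \<open>Apart from the common zero at the origin, no solution vanishes for an energy below \<open>0\<close> or
    at a position below \<open>\<delta>\<close>.\<close>
  define Z where "Z = {p \<in> {\<delta>..real L} \<times> {0..m}. shoot c (snd p) (fst p) = 0}"
  have inZ: "(x, \<mu>) \<in> Z" if "0 < x" "x \<le> real L" "\<mu> \<le> m" "shoot c \<mu> x = 0" for x \<mu>
  proof -
    have "0 < \<mu>" using pos that by blast
    then have "\<delta> \<le> x" using \<delta>(3)[of x \<mu>] that by force
    then show ?thesis using that \<open>0 < \<mu>\<close> by (simp add: Z_def)
  qed
  have "continuous_on ({\<delta>..real L} \<times> {0..m}) (\<lambda>p. shoot c (snd p) (fst p))"
    by (rule continuous_on_subset[OF continuous_on_shoot[of L]]) (use \<delta>(1) in auto)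
  then have "closed (({\<delta>..real L} \<times> {0..m}) \<inter> (\<lambda>p. shoot c (snd p) (fst p)) -` {0})"
    by (intro continuous_closed_preimage closed_Times) auto
  moreover have "({\<delta>..real L} \<times> {0..m}) \<inter> (\<lambda>p. shoot c (snd p) (fst p)) -` {0} = Z"
    by (auto simp: Z_def)
  ultimately have "closed Z" by simp
  have "Z \<subseteq> {\<delta>..real L} \<times> {0..m}" by (auto simp: Z_def)
  moreover have "compact ({\<delta>..real L} \<times> {0..m})" by (intro compact_Times compact_Icc)
  ultimately have "compact Z" using \<open>closed Z\<close> by (metis compact_Int_closed inf.absorb_iff2 inf_commute)
  moreover have "(x0, m) \<in> Z" using inZ x0 m by auto
  moreover have "continuous_on Z snd" by (intro continuous_on_snd continuous_on_id)
  ultimately obtain p where p: "p \<in> Z" "\<And>p'. p' \<in> Z \<Longrightarrow> snd p \<le> snd p'"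
    using continuous_attains_inf[of Z snd] by (metis empty_iff)
  define x \<mu>0 where "x = fst p" and "\<mu>0 = snd p"
  have x: "0 < x" "x \<le> real L" "\<mu>0 \<le> m" and zero: "shoot c \<mu>0 x = 0"
    using p(1) \<delta>(1) by (auto simp: Z_def x_def \<mu>0_def)
  have min: "\<mu>0 \<le> \<mu>" if "0 < y" "y \<le> real L" "shoot c \<mu> y = 0" for y \<mu>
    using p(2)[OF inZ[OF that(1,2) _ that(3)]] x by (cases "\<mu> \<le> m") (auto simp: \<mu>0_def)
  have "0 < \<mu>0" using pos zero x by blast
  have "x = real L"
  proof (rule ccontr)
    assume "x \<noteq> real L"
    with x have xL: "x < real L" by simp
    have "shoot' c \<mu>0 x \<noteq> 0" using traj_nondegenerate[of "\<lambda>j. c j - \<mu>0" 0 1 x] zero x by auto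
    have "(shoot c \<mu>0 has_real_derivative shoot' c \<mu>0 x) (at x within {real 0..real L})"
      by (rule cell_solution_deriv[OF traj_cell_solution]) (use L x in auto)
    then have D: "(shoot c \<mu>0 has_real_derivative shoot' c \<mu>0 x) (at x)"
      using x xL by (simp add: at_within_Icc_at)
    obtain d where d: "0 < d" "\<And>h. 0 < h \<Longrightarrow> h < d \<Longrightarrow> shoot c \<mu>0 (x - h) * shoot c \<mu>0 (x + h) < 0"
    proof (cases "0 < shoot' c \<mu>0 x")
      case True
      from DERIV_pos_inc_left[OF D True] DERIV_pos_inc_right[OF D True] zero
      obtain d1 d2 where "0 < d1" "0 < d2" "\<And>h. 0 < h \<Longrightarrow> h < d1 \<Longrightarrow> shoot c \<mu>0 (x - h) < 0"
        "\<And>h. 0 < h \<Longrightarrow> h < d2 \<Longrightarrow> 0 < shoot c \<mu>0 (x + h)" by auto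
      then show thesis by (intro that[of "min d1 d2"]) (auto intro: mult_neg_pos)
    next
      case False
      then have neg: "shoot' c \<mu>0 x < 0" using \<open>shoot' c \<mu>0 x \<noteq> 0\<close> by simp
      from DERIV_neg_dec_left[OF D neg] DERIV_neg_dec_right[OF D neg] zero
      obtain d1 d2 where "0 < d1" "0 < d2" "\<And>h. 0 < h \<Longrightarrow> h < d1 \<Longrightarrow> 0 < shoot c \<mu>0 (x - h)"
        "\<And>h. 0 < h \<Longrightarrow> h < d2 \<Longrightarrow> shoot c \<mu>0 (x + h) < 0" by auto
      then show thesis by (intro that[of "min d1 d2"]) (auto intro: mult_pos_neg)
    qed
    define h where "h = min (d / 2) (min (x / 2) ((real L - x) / 2))"
    have h: "0 < h" "h < d" "0 < x - h" "x + h < real L"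
      using d(1) x xL by (auto simp: h_def min_def field_simps)
    let ?F = "\<lambda>\<mu>. shoot c \<mu> (x - h) * shoot c \<mu> (x + h)"
    have "continuous_on UNIV ?F"
      using h x by (intro continuous_on_mult continuous_on_shoot_param) auto
    then have "isCont ?F \<mu>0" by (simp add: continuous_on_eq_continuous_at)
    then have "(?F \<longlongrightarrow> ?F \<mu>0) (at_left \<mu>0)"
      by (auto simp: continuous_within isCont_def intro: filterlim_mono[OF _ order_refl at_le])
    moreover have "?F \<mu>0 < 0" using d(2) h by blast
    ultimately have "\<forall>\<^sub>F \<mu> in at_left \<mu>0. ?F \<mu> < 0" by (rule order_tendstoD)
    moreover have "\<forall>\<^sub>F \<mu> in at_left \<mu>0. \<mu> < \<mu>0" by (simp add: eventually_at_filter)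
    ultimately have "\<forall>\<^sub>F \<mu> in at_left \<mu>0. ?F \<mu> < 0 \<and> \<mu> < \<mu>0" by eventually_elim simp
    then obtain \<mu> where \<mu>: "?F \<mu> < 0" "\<mu> < \<mu>0"
      using eventually_happens[of _ "at_left \<mu>0"] trivial_limit_at_left_real by blast
    have cont: "continuous_on {x - h..x + h} (shoot c \<mu>)"
      by (rule continuous_on_subset[OF cell_solution_continuous(1)[OF traj_cell_solution, of L]]) (use h in auto)
    have "\<exists>y\<in>{x - h..x + h}. shoot c \<mu> y = 0"
    proof (cases "shoot c \<mu> (x - h) \<le> 0")
      case True
      with \<mu>(1) have "0 \<le> shoot c \<mu> (x + h)" by (auto simp: mult_less_0_iff)
      with True show ?thesis using IVT'[of "shoot c \<mu>" "x - h" 0 "x + h"] cont h by auto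
    next
      case False
      with \<mu>(1) have "shoot c \<mu> (x + h) \<le> 0" by (auto simp: mult_less_0_iff)
      with False show ?thesis using IVT2'[of "shoot c \<mu>" "x + h" 0 "x - h"] cont h by auto
    qed
    then obtain y where "y \<in> {x - h..x + h}" "shoot c \<mu> y = 0" by blast
    then have "\<mu>0 \<le> \<mu>" using h by (intro min[of y]) auto
    with \<mu>(2) show False by simp
  qed
  show thesis
  proof (rule that[of \<mu>0])
    show "\<mu>0 \<le> m" "shoot c \<mu>0 (real L) = 0" using x zero \<open>x = real L\<close> by auto
    show "\<mu>0 \<le> \<mu>" if "shoot c \<mu> (real L) = 0" for \<mu> using min[of "real L"] that L by simp
  qed
qed

lemma ground_eigenvalue_le:
  assumes q: "\<And>x. 0 \<le> x \<Longrightarrow> x < real L \<Longrightarrow> q x = c (nat \<lfloor>x\<rfloor>)"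
    and c: "\<And>j. j < L \<Longrightarrow> 0 \<le> c j" and x0: "0 < x0" "x0 \<le> real L" and m: "shoot c m x0 = 0"
  shows "dirichlet_eigenvalue q (real L) (ground_eigenvalue q (real L))" "ground_eigenvalue q (real L) \<le> m"
proof -
  have L: "0 < L" using x0 by (cases L) auto
  obtain \<mu>0 where \<mu>0: "\<mu>0 \<le> m" "shoot c \<mu>0 (real L) = 0" "\<And>\<mu>. shoot c \<mu> (real L) = 0 \<Longrightarrow> \<mu>0 \<le> \<mu>"
    using shoot_least_root[of L c x0 m] c x0 m by blast
  note iff = dirichlet_eigenvalue_iff_shoot[where q = q and c = c, OF L q]
  have "ground_eigenvalue q (real L) = \<mu>0"
    unfolding ground_eigenvalue_def by (rule Least_equality) (use iff \<mu>0 in auto)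
  then show "dirichlet_eigenvalue q (real L) (ground_eigenvalue q (real L))" "ground_eigenvalue q (real L) \<le> m"
    using iff \<mu>0 by auto
qed

text \<open>
  On a well \<open>[a, b]\<close> where the coefficient is \<open>d\<close>, every solution for the energy
  \<open>d + (pi / (b - a))\<^sup>2\<close> is a combination of a cosine and a sine of half-period \<open>b - a\<close>, so its values at
  the two ends are opposite. Such a solution cannot stay positive on \<open>(0, L]\<close>.
\<close>

lemma ground_eigenvalue_le_of_well:
  assumes q: "\<And>x. 0 \<le> x \<Longrightarrow> x < real L \<Longrightarrow> q x = c (nat \<lfloor>x\<rfloor>)"
    and c: "\<And>j. j < L \<Longrightarrow> 0 \<le> c j" and ab: "a < b" "b \<le> L"
    and well: "\<And>j. a \<le> j \<Longrightarrow> j < b \<Longrightarrow> c j = d"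
  shows "dirichlet_eigenvalue q (real L) (ground_eigenvalue q (real L))"
    and "ground_eigenvalue q (real L) \<le> d + (pi / (real b - real a))\<^sup>2"
proof -
  define \<theta> where "\<theta> = pi / (real b - real a)"
  define m where "m = d + \<theta>\<^sup>2"
  have \<theta>: "0 < \<theta>" "\<theta> * (real b - real a) = pi" using ab by (auto simp: \<theta>_def)
  note cs = traj_cell_solution[of "\<lambda>j. c j - m" 0 L 0 1]
  \<comment> \<open>The Wronskian with the sine that vanishes at both ends of the well is constant.\<close>
  let ?p = "\<lambda>x. shoot c m x * (\<theta> * cos (\<theta> * (x - real a))) - shoot' c m x * sin (\<theta> * (x - real a))"
  have "(?p has_real_derivative 0) (at x within {real a..real b})" if x: "x \<in> {real a..real b}" for x
  proof -
    have D: "(shoot c m has_real_derivative shoot' c m x) (at x within {real a..real b})"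
      by (rule cell_solution_deriv[OF cs ab x])
    have D': "(shoot' c m has_real_derivative - \<theta>\<^sup>2 * shoot c m x - 0) (at x within {real a..real b})"
      by (rule cell_solution_deriv2[OF cs ab x]) (simp add: well m_def)
    show ?thesis
      by (rule derivative_eq_intros D D' refl | simp)+ (simp add: algebra_simps power2_eq_square)
  qed
  then obtain P where P: "\<And>x. x \<in> {real a..real b} \<Longrightarrow> ?p x = P"
    using has_field_derivative_zero_constant[of "{real a..real b}" ?p] by (metis (no_types, lifting) convex_real_interval(5))
  from P[of "real a"] P[of "real b"] ab have "?p (real a) = ?p (real b)" by simp
  then have "shoot c m (real a) * \<theta> = - (shoot c m (real b) * \<theta>)" using \<theta>(2) by simp
  then have "\<theta> * (shoot c m (real b) + shoot c m (real a)) = 0" by (simp add: algebra_simps)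
  with \<theta>(1) have anti: "shoot c m (real b) = - shoot c m (real a)" by simp
  have "\<exists>x0. 0 < x0 \<and> x0 \<le> real L \<and> shoot c m x0 = 0"
  proof (rule ccontr)
    assume no: "\<not> ?thesis"
    obtain \<delta> where \<delta>: "0 < \<delta>" "\<delta> \<le> 1" "\<And>x \<mu>. 0 < x \<Longrightarrow> x \<le> \<delta> \<Longrightarrow> \<bar>\<mu>\<bar> \<le> \<bar>m\<bar> \<Longrightarrow> 0 < shoot c \<mu> x"
      using shoot_pos_initially[of "\<bar>m\<bar>" c] by blast
    have pos: "0 < shoot c m x" if x: "0 < x" "x \<le> real L" for x
    proof (rule ccontr)
      assume neg: "\<not> 0 < shoot c m x"
      have "\<delta> < x" using \<delta>(3)[of x m] x neg by force
      moreover have "0 < shoot c m \<delta>" using \<delta>(1) \<delta>(3)[of \<delta> m] by simp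
      moreover have "continuous_on {\<delta>..x} (shoot c m)"
        by (rule continuous_on_subset[OF cell_solution_continuous(1)[OF cs]]) (use \<delta> x in auto)
      ultimately obtain y where "\<delta> \<le> y" "y \<le> x" "shoot c m y = 0"
        using IVT2'[of "shoot c m" x 0 \<delta>] neg by auto
      with no \<delta>(1) x show False by (metis less_le_trans order_trans)
    qed
    have "0 < shoot c m (real b)" using ab by (intro pos) auto
    moreover have "0 \<le> shoot c m (real a)" using pos[of "real a"] ab by (cases "a = 0") auto
    ultimately show False using anti by simp
  qed
  then obtain x0 where "0 < x0" "x0 \<le> real L" "shoot c m x0 = 0" by blast
  from ground_eigenvalue_le[OF q c this]
  show "dirichlet_eigenvalue q (real L) (ground_eigenvalue q (real L))"
    "ground_eigenvalue q (real L) \<le> d + (pi / (real b - real a))\<^sup>2"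
    by (auto simp: m_def \<theta>_def)
qed

section \<open>The landscape function\<close>

text \<open>
  Propagation with the comparison function \<open>1\<close>: a function that is convex where it is positive, and has
  only convex kinks, keeps growing once it has become positive, up to the right end of the interval.
\<close>

lemma cellwise_maximum_principle:
  fixes v v' v'' :: "nat \<Rightarrow> real \<Rightarrow> real"
  assumes dv: "\<And>j x. j < L \<Longrightarrow> x \<in> {real j..real j + 1} \<Longrightarrow>
      (v j has_real_derivative v' j x) (at x within {real j..real j + 1})"
    and dv': "\<And>j x. j < L \<Longrightarrow> x \<in> {real j..real j + 1} \<Longrightarrow>
      (v' j has_real_derivative v'' j x) (at x within {real j..real j + 1})"
    and convex: "\<And>j x. j < L \<Longrightarrow> x \<in> {real j..real j + 1} \<Longrightarrow> 0 < v j x \<Longrightarrow> 0 \<le> v'' j x"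
    and match: "\<And>j. Suc j < L \<Longrightarrow> v (Suc j) (real (Suc j)) = v j (real (Suc j))"
    and kink: "\<And>j. Suc j < L \<Longrightarrow> v' j (real (Suc j)) \<le> v' (Suc j) (real (Suc j))"
    and ends: "v 0 0 \<le> 0" "v (L - 1) (real L) \<le> 0"
    and i: "i < L" "x \<in> {real i..real i + 1}"
  shows "v i x \<le> 0"
proof (rule ccontr)
  assume "\<not> v i x \<le> 0"
  then have "0 < v i x" by simp
  have kink': "0 \<le> v' (Suc j) (real (Suc j))" if "Suc j < L" "0 \<le> v' j (real (Suc j))" for j
    using kink[OF that(1)] that(2) by simp
  have "0 < v (L - 1) (real L)"
    by (rule cellwise_propagation[where i = i and x = x and v = v and v' = v' and v'' = v'' and L = L
        and \<phi> = "\<lambda>_ _. 1" and \<phi>' = "\<lambda>_ _. 0" and \<phi>'' = "\<lambda>_ _. 0"])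
      (use dv dv' convex match ends i \<open>0 < v i x\<close> kink' in auto)
  with ends show False by simp
qed

text \<open>
  A positive supersolution \<open>\<phi>\<close> at the energy \<open>\<mu>\<close>, whose logarithmic derivative may drop at the
  integers, excludes eigenvalues up to \<open>\<mu>\<close>.
\<close>

lemma shoot_pos_of_supersolution:
  fixes \<phi> \<phi>' \<phi>'' :: "nat \<Rightarrow> real \<Rightarrow> real"
  assumes d\<phi>: "\<And>j x. j < L \<Longrightarrow> x \<in> {real j..real j + 1} \<Longrightarrow>
      (\<phi> j has_real_derivative \<phi>' j x) (at x within {real j..real j + 1})"
    and d\<phi>': "\<And>j x. j < L \<Longrightarrow> x \<in> {real j..real j + 1} \<Longrightarrow>
      (\<phi>' j has_real_derivative \<phi>'' j x) (at x within {real j..real j + 1})"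
    and pos: "\<And>j x. j < L \<Longrightarrow> x \<in> {real j..real j + 1} \<Longrightarrow> 0 < \<phi> j x"
    and super: "\<And>j x. j < L \<Longrightarrow> x \<in> {real j..real j + 1} \<Longrightarrow> \<phi>'' j x \<le> (c j - \<mu>) * \<phi> j x"
    and kink: "\<And>j. Suc j < L \<Longrightarrow>
      \<phi>' (Suc j) (real (Suc j)) * \<phi> j (real (Suc j)) \<le> \<phi>' j (real (Suc j)) * \<phi> (Suc j) (real (Suc j))"
    and "0 < L" and \<nu>: "\<nu> \<le> \<mu>"
  shows "0 < shoot c \<nu> (real L)"
proof -
  obtain \<delta> where \<delta>: "0 < \<delta>" "\<delta> \<le> 1" "\<And>x \<xi>. 0 < x \<Longrightarrow> x \<le> \<delta> \<Longrightarrow> \<bar>\<xi>\<bar> \<le> \<bar>\<nu>\<bar> \<Longrightarrow> 0 < shoot c \<xi> x"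
    using shoot_pos_initially[of "\<bar>\<nu>\<bar>" c] by blast
  have p\<delta>: "0 < shoot c \<nu> \<delta>" using \<delta>(1) by (intro \<delta>(3)) auto
  note cs = cell_solutionD[OF traj_cell_solution[of "\<lambda>j. c j - \<nu>" 0 L 0 1]]
  let ?v = "shoot c \<nu>" and ?v' = "shoot' c \<nu>"
  have "0 < (\<lambda>_. ?v) (L - 1) (real L)"
  proof (rule cellwise_propagation[where i = 0 and x = \<delta> and j = "L - 1" and L = L
        and v = "\<lambda>_. ?v" and v' = "\<lambda>_. ?v'" and v'' = "\<lambda>j x. (c j - \<nu>) * ?v x - 0"
        and \<phi> = \<phi> and \<phi>' = \<phi>' and \<phi>'' = \<phi>'', OF cs d\<phi> d\<phi>' pos])
    fix j x assume jx: "j < L" "x \<in> {real j..real j + 1}" "0 < ?v x"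
    have "\<phi>'' j x \<le> (c j - \<nu>) * \<phi> j x"
      by (rule order_trans[OF super[OF jx(1,2)] mult_right_mono])
        (use \<nu> pos[OF jx(1,2)] in auto)
    from mult_left_mono[OF this, of "?v x"] jx(3)
    show "?v x * \<phi>'' j x \<le> ((c j - \<nu>) * ?v x - 0) * \<phi> j x" by (simp add: mult_ac)
  next
    fix j assume j: "Suc j < L" and v: "0 < ?v (real (Suc j))"
      and W: "?v (real (Suc j)) * \<phi>' j (real (Suc j)) \<le> ?v' (real (Suc j)) * \<phi> j (real (Suc j))"
    define t where "t = real (Suc j)"
    have p: "0 < \<phi> j t" "0 < \<phi> (Suc j) t" using pos[of j t] pos[of "Suc j" t] j by (auto simp: t_def)
    have "\<phi> j t * (?v t * \<phi>' (Suc j) t) = ?v t * (\<phi>' (Suc j) t * \<phi> j t)" by simp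
    also have "\<dots> \<le> ?v t * (\<phi>' j t * \<phi> (Suc j) t)"
      using kink[OF j] v by (intro mult_left_mono) (simp_all add: t_def)
    also have "\<dots> = \<phi> (Suc j) t * (?v t * \<phi>' j t)" by simp
    also have "\<dots> \<le> \<phi> (Suc j) t * (?v' t * \<phi> j t)"
      using W p by (intro mult_left_mono) (simp_all add: t_def)
    also have "\<dots> = \<phi> j t * (?v' t * \<phi> (Suc j) t)" by simp
    finally show "?v (real (Suc j)) * \<phi>' (Suc j) (real (Suc j)) \<le> ?v' (real (Suc j)) * \<phi> (Suc j) (real (Suc j))"
      using p by (simp add: t_def)
  qed (use \<delta> p\<delta> \<open>0 < L\<close> in auto)
  then show ?thesis by simp
qed

lemma cell_solution_lincomb:
  assumes "cell_solution c r L v v'" "cell_solution c s L w w'"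
  shows "cell_solution c (r + m * s) L (\<lambda>x. v x + m * w x) (\<lambda>x. v' x + m * w' x)"
  unfolding cell_solution_def
proof (intro allI impI ballI conjI)
  fix j x assume j: "j < L" "x \<in> {real j..real j + 1}"
  show "((\<lambda>x. v x + m * w x) has_real_derivative v' x + m * w' x) (at x within {real j..real j + 1})"
    by (rule DERIV_add[OF cell_solutionD(1)[OF assms(1) j] DERIV_cmult[OF cell_solutionD(1)[OF assms(2) j]]])
  have "((\<lambda>x. v' x + m * w' x) has_real_derivative (c j * v x - r) + m * (c j * w x - s)) (at x within {real j..real j + 1})"
    by (rule DERIV_add[OF cell_solutionD(2)[OF assms(1) j] DERIV_cmult[OF cell_solutionD(2)[OF assms(2) j]]])
  then show "((\<lambda>x. v' x + m * w' x) has_real_derivative c j * (v x + m * w x) - (r + m * s)) (at x within {real j..real j + 1})"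
    by (simp add: algebra_simps)
qed

lemma cell_solution_cong:
  assumes "cell_solution c r L v v'" "\<And>x. x \<in> {0..real L} \<Longrightarrow> w x = v x"
  shows "cell_solution c r L w v'"
  unfolding cell_solution_def
proof (intro allI impI ballI conjI)
  fix j x assume j: "j < L" and x: "x \<in> {real j..real j + 1}"
  have eq: "v y = w y" if "y \<in> {real j..real j + 1}" for y using assms(2)[of y] that j by auto
  show "(w has_real_derivative v' x) (at x within {real j..real j + 1})"
    by (rule has_field_derivative_transform_within[OF cell_solutionD(1)[OF assms(1) j x] zero_less_one x]) (rule eq)
  show "(v' has_real_derivative c j * w x - r) (at x within {real j..real j + 1})"
    using cell_solutionD(2)[OF assms(1) j x] eq[OF x] by simp
qed

text \<open>
  Existence by superposition: the value at \<open>L\<close> of the solution of \<open>v'' = c j * v - 1\<close> with zero initial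
  data is corrected by a multiple of the homogeneous solution, which is positive at \<open>L\<close> because \<open>c \<ge> 0\<close>.
  The same positivity gives uniqueness.
\<close>

lemma landscape_cell_solution:
  assumes q: "\<And>x. 0 \<le> x \<Longrightarrow> x < real L \<Longrightarrow> q x = c (nat \<lfloor>x\<rfloor>)"
    and c: "\<And>j. j < L \<Longrightarrow> 0 \<le> c j" and L: "0 < L"
  obtains u' where "cell_solution c 1 L (landscape q (real L)) u'"
    "landscape q (real L) 0 = 0" "landscape q (real L) (real L) = 0"
proof -
  let ?P = "\<lambda>u. dirichlet_solution q (real L) u (\<lambda>x. 1) \<and> (\<forall>x. x \<notin> {0..real L} \<longrightarrow> u x = 0)"
  let ?y = "traj c 0 0 1"
  have yL: "0 < ?y (real L)" by (rule traj_pos_of_nonneg[OF c]) (use L in auto)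
  define m where "m = - traj c 1 0 0 (real L) / ?y (real L)"
  define u0 where "u0 x = traj c 1 0 0 x + m * ?y x" for x
  define u where "u x = (if x \<in> {0..real L} then u0 x else 0)" for x
  have "cell_solution c (1 + m * 0) L u0 (\<lambda>x. traj' c 1 0 0 x + m * traj' c 0 0 1 x)"
    unfolding u0_def[abs_def] by (rule cell_solution_lincomb[OF traj_cell_solution traj_cell_solution])
  then have cs0: "cell_solution c 1 L u0 (\<lambda>x. traj' c 1 0 0 x + m * traj' c 0 0 1 x)"
    by simp
  have "cell_solution c 1 L u (\<lambda>x. traj' c 1 0 0 x + m * traj' c 0 0 1 x)"
    by (rule cell_solution_cong[OF cs0]) (simp add: u_def)
  then have cs: "cell_solution (\<lambda>j. c j - 0) 1 L u (\<lambda>x. traj' c 1 0 0 x + m * traj' c 0 0 1 x)"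
    by simp
  have ends: "u 0 = 0" "u (real L) = 0" using yL by (simp_all add: u_def u0_def m_def)
  have "dirichlet_solution q (real L) u (\<lambda>x. 1)"
    by (rule dirichlet_solution_of_cell_solution[OF cs L ends q]) simp_all
  then have ex: "?P u" by (simp add: u_def)
  moreover have "v = w" if v: "?P v" and w: "?P w" for v w
  proof -
    obtain v' where v': "v 0 = 0" "v (real L) = 0" "cell_solution (\<lambda>j. c j - 0) 1 L v v'"
      by (rule cell_solution_of_dirichlet_solution[where c = c and \<mu> = 0 and r = 1, OF conjunct1[OF v] q]) simp_all
    obtain w' where w': "w 0 = 0" "w (real L) = 0" "cell_solution (\<lambda>j. c j - 0) 1 L w w'"
      by (rule cell_solution_of_dirichlet_solution[where c = c and \<mu> = 0 and r = 1, OF conjunct1[OF w] q]) simp_all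
    have cd: "cell_solution c 0 L (\<lambda>x. v x + (-1) * w x) (\<lambda>x. v' x + (-1) * w' x)"
      using cell_solution_lincomb[OF v'(3) w'(3), of "-1"] by simp
    have d: "v x + (-1) * w x = (v' 0 + (-1) * w' 0) * ?y x" if "x \<in> {0..real L}" for x
      using cell_solution_eq_traj[OF cd that] v'(1) w'(1) traj_scale[of c "v' 0 + (-1) * w' 0" x] by simp
    from d[of "real L"] v'(2) w'(2) yL have "v' 0 + (-1) * w' 0 = 0" by auto
    with d have "v x = w x" if "x \<in> {0..real L}" for x using that by simp
    moreover have "v x = w x" if "x \<notin> {0..real L}" for x using v w that by simp
    ultimately show "v = w" by blast
  qed
  ultimately have "landscape q (real L) = u" unfolding landscape_def by (intro the_equality) blast+
  with cs ends show thesis by (intro that) auto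
qed

lemma landscape_le_supersolution:
  fixes \<psi> \<psi>' \<psi>'' :: "nat \<Rightarrow> real \<Rightarrow> real"
  assumes q: "\<And>x. 0 \<le> x \<Longrightarrow> x < real L \<Longrightarrow> q x = c (nat \<lfloor>x\<rfloor>)"
    and c: "\<And>j. j < L \<Longrightarrow> 0 \<le> c j"
    and d\<psi>: "\<And>j x. j < L \<Longrightarrow> x \<in> {real j..real j + 1} \<Longrightarrow>
      (\<psi> j has_real_derivative \<psi>' j x) (at x within {real j..real j + 1})"
    and d\<psi>': "\<And>j x. j < L \<Longrightarrow> x \<in> {real j..real j + 1} \<Longrightarrow>
      (\<psi>' j has_real_derivative \<psi>'' j x) (at x within {real j..real j + 1})"
    and super: "\<And>j x. j < L \<Longrightarrow> x \<in> {real j..real j + 1} \<Longrightarrow> \<psi>'' j x \<le> c j * \<psi> j x - 1"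
    and match: "\<And>j. Suc j < L \<Longrightarrow> \<psi> (Suc j) (real (Suc j)) = \<psi> j (real (Suc j))"
    and kink: "\<And>j. Suc j < L \<Longrightarrow> \<psi>' (Suc j) (real (Suc j)) \<le> \<psi>' j (real (Suc j))"
    and ends: "0 \<le> \<psi> 0 0" "0 \<le> \<psi> (L - 1) (real L)"
    and i: "i < L" "x \<in> {real i..real i + 1}"
  shows "landscape q (real L) x \<le> \<psi> i x"
proof -
  have "0 < L" using i by simp
  obtain u' where u': "cell_solution c 1 L (landscape q (real L)) u'"
    "landscape q (real L) 0 = 0" "landscape q (real L) (real L) = 0"
    using landscape_cell_solution[where q = q and c = c, OF q c \<open>0 < L\<close>] by blast
  let ?u = "landscape q (real L)"
  have "(\<lambda>j x. ?u x - \<psi> j x) i x \<le> 0"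
  proof (rule cellwise_maximum_principle[where L = L and v = "\<lambda>j x. ?u x - \<psi> j x" and v' = "\<lambda>j x. u' x - \<psi>' j x"
        and v'' = "\<lambda>j x. (c j * ?u x - 1) - \<psi>'' j x"])
    fix j x assume j: "j < L" "x \<in> {real j..real j + 1}"
    show "((\<lambda>x. ?u x - \<psi> j x) has_real_derivative u' x - \<psi>' j x) (at x within {real j..real j + 1})"
      by (rule DERIV_diff[OF cell_solutionD(1)[OF u'(1) j] d\<psi>[OF j]])
    show "((\<lambda>x. u' x - \<psi>' j x) has_real_derivative (c j * ?u x - 1) - \<psi>'' j x) (at x within {real j..real j + 1})"
      by (rule DERIV_diff[OF cell_solutionD(2)[OF u'(1) j] d\<psi>'[OF j]])
    assume "0 < ?u x - \<psi> j x"
    then have "0 \<le> c j * (?u x - \<psi> j x)" using c[OF j(1)] by simp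
    then show "0 \<le> (c j * ?u x - 1) - \<psi>'' j x" using super[OF j] by (simp add: algebra_simps)
  next
    fix j assume "Suc j < L"
    then show "?u (real (Suc j)) - \<psi> (Suc j) (real (Suc j)) = ?u (real (Suc j)) - \<psi> j (real (Suc j))"
      "u' (real (Suc j)) - \<psi>' j (real (Suc j)) \<le> u' (real (Suc j)) - \<psi>' (Suc j) (real (Suc j))"
      using match kink by auto
  qed (use u' ends i in auto)
  then show ?thesis by simp
qed

text \<open>
  A small multiple of \<open>x * (L - x)\<close> is a subsolution.
\<close>

lemma landscape_pos:
  assumes q: "\<And>x. 0 \<le> x \<Longrightarrow> x < real L \<Longrightarrow> q x = c (nat \<lfloor>x\<rfloor>)"
    and c: "\<And>j. j < L \<Longrightarrow> 0 \<le> c j" and x: "0 < x" "x < real L"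
  shows "0 < landscape q (real L) x"
proof -
  have L: "0 < L" using x by (cases L) auto
  obtain u' where u': "cell_solution c 1 L (landscape q (real L)) u'"
    "landscape q (real L) 0 = 0" "landscape q (real L) (real L) = 0"
    using landscape_cell_solution[where q = q and c = c, OF q c L] by blast
  let ?u = "landscape q (real L)"
  define K where "K = (\<Sum>j<L. c j)"
  have K: "0 \<le> K" "\<And>j. j < L \<Longrightarrow> c j \<le> K"
    using c by (auto simp: K_def intro!: sum_nonneg member_le_sum)
  \<comment> \<open>Chosen such that \<open>K * s x \<le> 1 - \<epsilon>\<close> for \<open>s x = \<epsilon> * (x * (L - x)) / 2\<close>, whose second derivative
    is \<open>- \<epsilon>\<close>.\<close>
  define \<epsilon> where "\<epsilon> = 1 / (1 + K * (real L)\<^sup>2)"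
  have \<epsilon>: "0 < \<epsilon>" "\<epsilon> * (1 + K * (real L)\<^sup>2) = 1" 
  proof -
    have "0 < 1 + K * (real L)\<^sup>2" using K(1) by (intro add_pos_nonneg) simp_all
    then show "0 < \<epsilon>" "\<epsilon> * (1 + K * (real L)\<^sup>2) = 1" by (simp_all add: \<epsilon>_def)
  qed
  define s where "s x = \<epsilon> * (x * (real L - x)) / 2" for x
  obtain i where i: "i < L" "x \<in> {real i..real i + 1}" using obtain_closed_cell[of x L] x L by auto
  have "(\<lambda>_ x. s x - ?u x) i x \<le> 0"
  proof (rule cellwise_maximum_principle[where L = L and v = "\<lambda>_ x. s x - ?u x" and v' = "\<lambda>_ x. \<epsilon> * (real L - 2 * x) / 2 - u' x"
        and v'' = "\<lambda>j x. - \<epsilon> - (c j * ?u x - 1)"])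
    fix j x assume j: "j < L" "x \<in> {real j..real j + 1}"
    have "(s has_real_derivative \<epsilon> * (real L - 2 * x) / 2) (at x within {real j..real j + 1})"
      unfolding s_def[abs_def] by (auto intro!: derivative_eq_intros simp: field_simps)
    then show "((\<lambda>x. s x - ?u x) has_real_derivative \<epsilon> * (real L - 2 * x) / 2 - u' x) (at x within {real j..real j + 1})"
      by (rule DERIV_diff[OF _ cell_solutionD(1)[OF u'(1) j]])
    have "((\<lambda>x. \<epsilon> * (real L - 2 * x) / 2) has_real_derivative - \<epsilon>) (at x within {real j..real j + 1})"
      by (auto intro!: derivative_eq_intros)
    then show "((\<lambda>x. \<epsilon> * (real L - 2 * x) / 2 - u' x) has_real_derivative - \<epsilon> - (c j * ?u x - 1)) (at x within {real j..real j + 1})"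
      by (rule DERIV_diff[OF _ cell_solutionD(2)[OF u'(1) j]])
    assume v: "0 < s x - ?u x"
    have x: "0 \<le> x" "x \<le> real L" using j by auto
    have "x * (real L - x) \<le> real L * real L" using x by (intro mult_mono) auto
    moreover have "0 \<le> x * (real L - x)" using x by simp
    ultimately have "x * (real L - x) / 2 \<le> (real L)\<^sup>2" by (simp add: power2_eq_square)
    then have "c j * (x * (real L - x) / 2) \<le> K * (real L)\<^sup>2"
      using K(2)[OF j(1)] K(1) \<open>0 \<le> x * (real L - x)\<close> by (intro mult_mono) auto
    then have "\<epsilon> * (c j * (x * (real L - x) / 2)) \<le> \<epsilon> * (K * (real L)\<^sup>2)"
      using \<epsilon>(1) by (intro mult_left_mono) auto
    moreover have "\<epsilon> * (c j * (x * (real L - x) / 2)) = c j * s x" by (simp add: s_def)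
    moreover have "\<epsilon> * (K * (real L)\<^sup>2) = 1 - \<epsilon>" using \<epsilon>(2) by (simp add: distrib_left)
    ultimately have "c j * s x \<le> 1 - \<epsilon>" by metis
    moreover have "c j * ?u x \<le> c j * s x" using v c[OF j(1)] by (intro mult_left_mono) auto
    ultimately show "0 \<le> - \<epsilon> - (c j * ?u x - 1)" by simp
  qed (use u' i in \<open>auto simp: s_def\<close>)
  moreover have "0 < s x" using \<epsilon>(1) x by (simp add: s_def)
  ultimately show ?thesis by simp
qed

text \<open>
  Positivity matters here: with \<open>1 / 0 = 0\<close>, an interior zero of the landscape function would be the
  least value of its reciprocal.
\<close>

lemma min_inverse_landscape_eq:
  assumes q: "\<And>x. 0 \<le> x \<Longrightarrow> x < real L \<Longrightarrow> q x = c (nat \<lfloor>x\<rfloor>)"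
    and c: "\<And>j. j < L \<Longrightarrow> 0 \<le> c j" and L: "0 < L"
  obtains x where "0 < x" "x < real L" "min_inverse_landscape q (real L) = 1 / landscape q (real L) x"
    "\<And>y. 0 < y \<Longrightarrow> y < real L \<Longrightarrow> landscape q (real L) y \<le> landscape q (real L) x"
proof -
  obtain u' where u': "cell_solution c 1 L (landscape q (real L)) u'"
    "landscape q (real L) 0 = 0" "landscape q (real L) (real L) = 0"
    using landscape_cell_solution[where q = q and c = c, OF q c L] by blast
  let ?u = "landscape q (real L)"
  obtain x where x: "x \<in> {0..real L}" "\<And>y. y \<in> {0..real L} \<Longrightarrow> ?u y \<le> ?u x"
    using continuous_attains_sup[OF compact_Icc _ cell_solution_continuous(1)[OF u'(1)]] L by fastforce
  note pos = landscape_pos[where q = q and c = c and L = L, OF q c]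
  have "0 < ?u (real L / 2)" using L by (intro pos) auto
  also have "\<dots> \<le> ?u x" using L by (intro x(2)) auto
  finally have "0 < ?u x" .
  with u'(2,3) have "x \<noteq> 0" "x \<noteq> real L" by (metis less_irrefl)+
  with x(1) have in0: "0 < x" "x < real L" by auto
  have "min_inverse_landscape q (real L) = 1 / ?u x"
    unfolding min_inverse_landscape_def
  proof (rule Least_equality)
    show "1 / ?u x \<in> (\<lambda>x. 1 / ?u x) ` {0<..<real L}" using in0 by auto
    fix m assume "m \<in> (\<lambda>x. 1 / ?u x) ` {0<..<real L}"
    then obtain y where "0 < y" "y < real L" "m = 1 / ?u y" by auto
    then show "1 / ?u x \<le> m" using pos[where x = y] x(2)[of y] by (simp add: frac_le)
  qed
  with in0 x(2) that show thesis by simp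
qed

text \<open>
  On a run of zeros the landscape function is the parabola \<open>(x - a) * (b - x) / 2\<close> plus an affine
  function with nonnegative values at both ends.
\<close>

lemma landscape_ge_of_well:
  assumes q: "\<And>x. 0 \<le> x \<Longrightarrow> x < real L \<Longrightarrow> q x = c (nat \<lfloor>x\<rfloor>)"
    and c: "\<And>j. j < L \<Longrightarrow> 0 \<le> c j" and ab: "a < b" "b \<le> L"
    and well: "\<And>j. a \<le> j \<Longrightarrow> j < b \<Longrightarrow> c j = 0"
  shows "(real b - real a)\<^sup>2 / 8 \<le> landscape q (real L) ((real a + real b) / 2)"
proof -
  have L: "0 < L" using ab by simp
  obtain u' where u': "cell_solution c 1 L (landscape q (real L)) u'"
    "landscape q (real L) 0 = 0" "landscape q (real L) (real L) = 0"
    using landscape_cell_solution[where q = q and c = c, OF q c L] by blast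
  let ?u = "landscape q (real L)"
  note pos = landscape_pos[where q = q and c = c and L = L, OF q c]
  have nonneg: "0 \<le> ?u x" if "x \<in> {0..real L}" for x
    using pos[where x = x] u'(2,3) that by (cases "x = 0 \<or> x = real L") auto
  let ?S = "{real a..real b}"
  have D: "(?u has_real_derivative u' x) (at x within ?S)"
    and D': "(u' has_real_derivative 0 * ?u x - 1) (at x within ?S)" if "x \<in> ?S" for x
    by (rule cell_solution_deriv[OF u'(1) ab that], rule cell_solution_deriv2[OF u'(1) ab that well])
  have "((\<lambda>x. u' x + x) has_real_derivative (0 * ?u x - 1) + 1) (at x within ?S)" if "x \<in> ?S" for x
    by (rule DERIV_add[OF D'[OF that] DERIV_ident])
  then obtain A where A: "\<And>x. x \<in> ?S \<Longrightarrow> u' x + x = A"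
    using has_field_derivative_zero_constant[of ?S "\<lambda>x. u' x + x"] by auto
  have "((\<lambda>x. ?u x + (x\<^sup>2 / 2 - A * x)) has_real_derivative u' x + (x - A)) (at x within ?S)" if "x \<in> ?S" for x
    by (rule DERIV_add[OF D[OF that]]) (auto intro!: derivative_eq_intros)
  then have "((\<lambda>x. ?u x + (x\<^sup>2 / 2 - A * x)) has_real_derivative 0) (at x within ?S)" if "x \<in> ?S" for x
    using A[OF that] that by force
  then obtain B where B: "\<And>x. x \<in> ?S \<Longrightarrow> ?u x + (x\<^sup>2 / 2 - A * x) = B"
    using has_field_derivative_zero_constant[of ?S "\<lambda>x. ?u x + (x\<^sup>2 / 2 - A * x)"] by auto
  have "?u ((real a + real b) / 2) = (?u (real a) + ?u (real b)) / 2 + (real b - real a)\<^sup>2 / 8"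
    using B[of "real a"] B[of "real b"] B[of "(real a + real b) / 2"] ab
    by (simp add: field_simps power2_eq_square)
  moreover have "0 \<le> ?u (real a)" "0 \<le> ?u (real b)" using ab by (auto intro!: nonneg)
  ultimately show ?thesis by simp
qed

section \<open>Runs of zeros and comparison functions\<close>

text \<open>
  For a cell \<open>j\<close> with \<open>z j\<close>, the maximal run of such cells around \<open>j\<close> inside \<open>{0..<L}\<close> is
  \<open>{run_start z j..<run_end z L j}\<close>. Along a run both ends stay the same, and next to a cell
  where \<open>z\<close> fails they reduce to the integer between the two cells.
\<close>

primrec run_start :: "(nat \<Rightarrow> bool) \<Rightarrow> nat \<Rightarrow> nat" where
  "run_start z 0 = 0"
| "run_start z (Suc j) = (if z j then run_start z j else Suc j)"

definition run_end :: "(nat \<Rightarrow> bool) \<Rightarrow> nat \<Rightarrow> nat \<Rightarrow> nat" where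
  "run_end z L j = (LEAST n. j \<le> n \<and> (n = L \<or> \<not> z n))"

lemma run_start_le: "run_start z j \<le> j"
  by (induction j) auto

lemma run_start_zeros: "run_start z j \<le> i \<Longrightarrow> i < j \<Longrightarrow> z i"
  by (induction j) (auto simp: less_Suc_eq split: if_splits)

lemma run_end_props:
  assumes "j \<le> L"
  shows "j \<le> run_end z L j" "run_end z L j \<le> L" "j \<le> i \<Longrightarrow> i < run_end z L j \<Longrightarrow> z i"
proof -
  let ?P = "\<lambda>n. j \<le> n \<and> (n = L \<or> \<not> z n)"
  have "?P L" using assms by simp
  then show "j \<le> run_end z L j" "run_end z L j \<le> L"
    unfolding run_end_def by (metis (mono_tags, lifting) LeastI, metis (mono_tags, lifting) Least_le)
  show "z i" if "j \<le> i" "i < run_end z L j"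
    using that not_less_Least[of i ?P] unfolding run_end_def by blast
qed

lemma run_end_wall: "j = L \<or> \<not> z j \<Longrightarrow> run_end z L j = j"
  unfolding run_end_def by (rule Least_equality) auto

lemma run_end_step:
  assumes "j < L" "z j" shows "run_end z L (Suc j) = run_end z L j"
proof -
  have "(\<lambda>n. Suc j \<le> n \<and> (n = L \<or> \<not> z n)) = (\<lambda>n. j \<le> n \<and> (n = L \<or> \<not> z n))"
    using assms by (auto simp: fun_eq_iff Suc_le_eq order_le_less)
  then show ?thesis by (simp add: run_end_def)
qed

text \<open>
  The inequality \<open>t \<le> tan t\<close> without a denominator.
\<close>

lemma x_cos_le_sin:
  assumes "0 \<le> t" "t \<le> pi" shows "t * cos t \<le> sin t"
proof -
  have "sin 0 - 0 * cos 0 \<le> sin t - t * cos t"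
  proof (rule DERIV_nonneg_imp_nondecreasing[where f = "\<lambda>t. sin t - t * cos t"])
    fix x assume "0 \<le> x" "x \<le> t"
    have "((\<lambda>t. sin t - t * cos t) has_real_derivative x * sin x) (at x)"
      by (auto intro!: derivative_eq_intros)
    moreover have "0 \<le> x * sin x" using \<open>0 \<le> x\<close> \<open>x \<le> t\<close> assms by (intro mult_nonneg_nonneg sin_ge_zero) auto
    ultimately show "\<exists>y. ((\<lambda>t. sin t - t * cos t) has_real_derivative y) (at x) \<and> 0 \<le> y" by blast
  qed (use assms in auto)
  then show ?thesis by simp
qed

text \<open>
  With \<open>\<kappa> = sqrt (k / 2)\<close>, the logarithmic derivative of \<open>cosh (\<kappa> * (x - m))\<close> at the ends of a wall of
  width \<open>1\<close> centred at \<open>m\<close> is \<open>\<kappa> * tanh (\<kappa> / 2)\<close> in absolute value, and \<open>penetration k\<close> is twice the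
  reciprocal of this number. Only half of the height \<open>k\<close> is used, which leaves room for an energy of up
  to \<open>k / 2\<close>.
\<close>

definition penetration :: "real \<Rightarrow> real" where
  "penetration k = 2 / (sqrt (k / 2) * tanh (sqrt (k / 2) / 2))"

lemma penetration_pos: "0 < k \<Longrightarrow> 0 < penetration k"
  by (simp add: penetration_def)

lemma penetration_cosh:
  assumes "0 < k"
  shows "penetration k * (sqrt (k / 2) * sinh (sqrt (k / 2) / 2)) = 2 * cosh (sqrt (k / 2) / 2)"
  using assms by (simp add: penetration_def tanh_def)

lemma tendsto_penetration: "(penetration \<longlongrightarrow> 0) at_top"
proof -
  have half: "filterlim (\<lambda>x::real. x / 2) at_top at_top"
    using filterlim_tendsto_pos_mult_at_top[OF tendsto_const[of "1/2 :: real"] _ filterlim_ident] by simp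
  have k: "filterlim (\<lambda>k::real. sqrt (k / 2)) at_top at_top"
    by (rule filterlim_compose[OF sqrt_at_top half])
  have "filterlim (\<lambda>k::real. sqrt (k / 2) / 2) at_top at_top"
    by (rule filterlim_compose[OF half k])
  then have "((\<lambda>k::real. tanh (sqrt (k / 2) / 2)) \<longlongrightarrow> 1) at_top"
    by (rule filterlim_compose[OF tanh_real_at_top])
  then have "filterlim (\<lambda>k::real. tanh (sqrt (k / 2) / 2) * sqrt (k / 2)) at_top at_top"
    by (rule filterlim_tendsto_pos_mult_at_top[OF _ zero_less_one k])
  then have "filterlim (\<lambda>k::real. sqrt (k / 2) * tanh (sqrt (k / 2) / 2)) at_top at_top"
    by (simp add: mult.commute)
  then show ?thesis unfolding penetration_def[abs_def]
    by (intro tendsto_divide_0[OF tendsto_const] filterlim_at_top_imp_at_infinity)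
qed

lemma DERIV_cos_affine:
  "((\<lambda>x. cos (\<theta> * (x - m))) has_real_derivative - \<theta> * sin (\<theta> * (x - m))) (at x within S)"
  "((\<lambda>x. - \<theta> * sin (\<theta> * (x - m))) has_real_derivative - \<theta>\<^sup>2 * cos (\<theta> * (x - m))) (at x within S)"
  by (auto intro!: derivative_eq_intros simp: power2_eq_square)

lemma DERIV_cosh_affine:
  fixes \<kappa> m d :: real
  shows "((\<lambda>x. e + d * cosh (\<kappa> * (x - m))) has_real_derivative d * \<kappa> * sinh (\<kappa> * (x - m))) (at x within S)"
  "((\<lambda>x. d * \<kappa> * sinh (\<kappa> * (x - m))) has_real_derivative d * \<kappa>\<^sup>2 * cosh (\<kappa> * (x - m))) (at x within S)"
  by (auto intro!: derivative_eq_intros simp: power2_eq_square)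

definition longest_run :: "(nat \<Rightarrow> bool) \<Rightarrow> nat \<Rightarrow> nat" where
  "longest_run z L = Max {b - a | a b. a \<le> b \<and> b \<le> L \<and> (\<forall>i\<in>{a..<b}. z i)}"

lemma
  shows longest_run_ge: "a \<le> b \<Longrightarrow> b \<le> L \<Longrightarrow> (\<And>i. a \<le> i \<Longrightarrow> i < b \<Longrightarrow> z i) \<Longrightarrow> b - a \<le> longest_run z L"
    and longest_run_attained: "\<exists>a b. a \<le> b \<and> b \<le> L \<and> (\<forall>i\<in>{a..<b}. z i) \<and> longest_run z L = b - a"
proof -
  let ?R = "{b - a | a b. a \<le> b \<and> b \<le> L \<and> (\<forall>i\<in>{a..<b}. z i)}"
  have fin: "finite ?R" by (rule finite_subset[of _ "{..L}"]) auto
  then show "a \<le> b \<Longrightarrow> b \<le> L \<Longrightarrow> (\<And>i. a \<le> i \<Longrightarrow> i < b \<Longrightarrow> z i) \<Longrightarrow> b - a \<le> longest_run z L"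
    unfolding longest_run_def by (intro Max_ge) (auto simp: Ball_def)
  have "0 - 0 \<in> ?R" by (rule CollectI) (rule exI[of _ 0], rule exI[of _ 0], simp)
  then have "longest_run z L \<in> ?R" unfolding longest_run_def by (intro Max_in[OF fin]) blast
  then show "\<exists>a b. a \<le> b \<and> b \<le> L \<and> (\<forall>i\<in>{a..<b}. z i) \<and> longest_run z L = b - a" by blast
qed

lemma run_bounds:
  assumes j: "j < L"
  shows "real (run_start z j) \<le> real j" "real (run_end z L j) - real (run_start z j) \<le> real (longest_run z L)"
    "z j \<Longrightarrow> real j + 1 \<le> real (run_end z L j)"
proof -
  note s = run_start_le[of z j] and e = run_end_props[where j = j and L = L and z = z, OF less_imp_le[OF j]]
  show "real (run_start z j) \<le> real j" using s by simp
  have "run_end z L j - run_start z j \<le> longest_run z L"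
  proof (rule longest_run_ge)
    show "run_start z j \<le> run_end z L j" "run_end z L j \<le> L" using s e by auto
    show "z i" if "run_start z j \<le> i" "i < run_end z L j" for i
      using that e(3)[where i = i] run_start_zeros[of z j i] by (cases "i < j") auto
  qed
  then show "real (run_end z L j) - real (run_start z j) \<le> real (longest_run z L)" by linarith
  show "real j + 1 \<le> real (run_end z L j)" if "z j"
    using run_end_step[where z = z, OF j that] run_end_props(1)[of "Suc j" L z] j by simp
qed

text \<open>
  No eigenvalue lies below \<open>\<theta>\<^sup>2\<close>. The comparison function is \<open>cos (\<theta> * (x - m))\<close> on a run with midpoint
  \<open>m\<close> and \<open>cosh (\<kappa> * (x - m))\<close> on a wall cell with midpoint \<open>m\<close>. Its logarithmic derivative drops at
  the boundary of a run of length \<open>r\<close> if \<open>\<theta> * tan (\<theta> * r / 2) \<le> \<kappa> * tanh (\<kappa> / 2)\<close>. For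
  \<open>\<theta> = pi / (l + C)\<close> and \<open>r = l\<close> the left side is \<open>\<theta> * cot (\<theta> * C / 2) \<le> 2 / C\<close>, which explains the
  choice of \<open>C\<close>. Between two wall cells the derivative drops from positive to negative.
\<close>

lemma shoot_pos_of_short_runs:
  assumes k: "0 < k" and L: "0 < L"
    and l: "l = longest_run z L"
    and \<theta>: "\<theta> = pi / (real l + penetration k)" "\<theta>\<^sup>2 \<le> k / 2" and \<nu>: "\<nu> \<le> \<theta>\<^sup>2"
  shows "0 < shoot (\<lambda>j. if z j then 0 else k) \<nu> (real L)"
proof -
  define \<kappa> where "\<kappa> = sqrt (k / 2)"
  have \<kappa>: "0 < \<kappa>" "\<kappa>\<^sup>2 = k / 2" using k by (auto simp: \<kappa>_def)
  define C where "C = penetration k"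
  have C: "0 < C" "C * (\<kappa> * sinh (\<kappa> / 2)) = 2 * cosh (\<kappa> / 2)"
    using penetration_pos[OF k] penetration_cosh[OF k] by (auto simp: C_def \<kappa>_def)
  have \<theta>0: "0 < \<theta>" and \<theta>l: "\<theta> * (real l / 2) = pi / 2 - \<theta> * C / 2"
    using C(1) unfolding \<theta>(1) C_def[symmetric] by (auto simp: field_simps add_nonneg_pos)
  have sinh0: "0 < sinh (\<kappa> / 2)" using \<kappa> by simp
  \<comment> \<open>The kink condition \<open>\<theta> * tan (\<theta> * r / 2) \<le> \<kappa> * tanh (\<kappa> / 2)\<close> without denominators; \<open>t\<close> below is
    the complement of the phase reached at the end of a run of length \<open>l\<close>.\<close>
  have core: "\<theta> * sin (\<theta> * (r / 2)) * cosh (\<kappa> / 2) \<le> \<kappa> * sinh (\<kappa> / 2) * cos (\<theta> * (r / 2))"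
    if r: "0 \<le> r" "r \<le> real l" for r
  proof -
    define t where "t = \<theta> * C / 2"
    have t: "0 < t" "t \<le> pi / 2"
    proof -
      show "0 < t" using \<theta>0 C by (simp add: t_def)
      have "0 \<le> \<theta> * (real l / 2)" using \<theta>0 by simp
      then show "t \<le> pi / 2" using \<theta>l by (simp add: t_def)
    qed
    have "\<theta> * (r / 2) \<le> \<theta> * (real l / 2)" using r \<theta>0 by (intro mult_left_mono) auto
    then have le: "\<theta> * (r / 2) \<le> pi / 2 - t" "0 \<le> \<theta> * (r / 2)"
      using r \<theta>0 unfolding \<theta>l by (auto simp: t_def)
    have "sin (\<theta> * (r / 2)) \<le> sin (pi / 2 - t)" using le t by (intro sin_monotone_2pi_le) auto
    then have s: "sin (\<theta> * (r / 2)) \<le> cos t" by (simp add: sin_diff)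
    have "cos (pi / 2 - t) \<le> cos (\<theta> * (r / 2))" using le t by (intro cos_monotone_0_pi_le) auto
    then have c: "sin t \<le> cos (\<theta> * (r / 2))" by (simp add: cos_diff)
    have "\<theta> * sin (\<theta> * (r / 2)) * cosh (\<kappa> / 2) \<le> \<theta> * cos t * cosh (\<kappa> / 2)"
      using s \<theta>0 by (intro mult_right_mono mult_left_mono) auto
    also have "\<dots> = \<kappa> * sinh (\<kappa> / 2) * (t * cos t)"
    proof -
      have "\<kappa> * sinh (\<kappa> / 2) * (t * y) = C * (\<kappa> * sinh (\<kappa> / 2)) * (\<theta> * y / 2)" for y
        by (simp add: t_def)
      from this[of "cos t"] have "\<kappa> * sinh (\<kappa> / 2) * (t * cos t) = 2 * cosh (\<kappa> / 2) * (\<theta> * cos t / 2)"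
        unfolding C(2) .
      also have "\<dots> = \<theta> * cos t * cosh (\<kappa> / 2)" by simp
      finally show ?thesis by (rule sym)
    qed
    also have "\<dots> \<le> \<kappa> * sinh (\<kappa> / 2) * cos (\<theta> * (r / 2))"
      using x_cos_le_sin[of t] t c \<kappa> sinh0 by (intro mult_left_mono) auto
    finally show ?thesis .
  qed
  define mid where "mid j = (real (run_start z j) + real (run_end z L j)) / 2" for j
  define \<phi> where "\<phi> j = (if z j then (\<lambda>x. cos (\<theta> * (x - mid j))) else (\<lambda>x. 0 + 1 * cosh (\<kappa> * (x - (real j + 1/2)))))" for j
  define \<phi>' where "\<phi>' j = (if z j then (\<lambda>x. - \<theta> * sin (\<theta> * (x - mid j))) else (\<lambda>x. 1 * \<kappa> * sinh (\<kappa> * (x - (real j + 1/2)))))" for j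
  define \<phi>'' where "\<phi>'' j = (if z j then (\<lambda>x. - \<theta>\<^sup>2 * cos (\<theta> * (x - mid j))) else (\<lambda>x. 1 * \<kappa>\<^sup>2 * cosh (\<kappa> * (x - (real j + 1/2)))))" for j
  have \<phi>_eq: "\<phi> j x = (if z j then cos (\<theta> * (x - mid j)) else cosh (\<kappa> * (x - (real j + 1/2))))"
    and \<phi>'_eq: "\<phi>' j x = (if z j then - \<theta> * sin (\<theta> * (x - mid j)) else \<kappa> * sinh (\<kappa> * (x - (real j + 1/2))))"
    and \<phi>''_eq: "\<phi>'' j x = (if z j then - \<theta>\<^sup>2 * cos (\<theta> * (x - mid j)) else \<kappa>\<^sup>2 * cosh (\<kappa> * (x - (real j + 1/2))))" for j x
    unfolding \<phi>_def \<phi>'_def \<phi>''_def by (simp_all only: if_distribR mult_1 add_0)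
  note rb = run_bounds[where z = z and L = L, folded l]
  show ?thesis
  proof (rule shoot_pos_of_supersolution[where c = "\<lambda>j. if z j then 0 else k" and \<phi> = \<phi> and \<phi>' = \<phi>' and \<phi>'' = \<phi>'', OF _ _ _ _ _ L \<nu>])
    fix j x assume j: "j < L" and x: "x \<in> {real j..real j + 1}"
    show "(\<phi> j has_real_derivative \<phi>' j x) (at x within {real j..real j + 1})"
      "(\<phi>' j has_real_derivative \<phi>'' j x) (at x within {real j..real j + 1})"
      unfolding \<phi>_def \<phi>'_def \<phi>''_def
      by (cases "z j"; simp only: if_True if_False DERIV_cos_affine DERIV_cosh_affine)+
    show pos: "0 < \<phi> j x"
    proof (cases "z j")
      case True
      have "\<bar>x - mid j\<bar> \<le> real l / 2"
        using rb(1,2)[OF j] rb(3)[OF j True] x by (auto simp: mid_def abs_le_iff field_simps)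
      then have "\<bar>\<theta> * (x - mid j)\<bar> \<le> \<theta> * (real l / 2)"
        unfolding abs_mult using \<theta>0 by (intro mult_mono) auto
      also have "\<dots> < pi / 2" using \<theta>l C \<theta>0 by simp
      finally show ?thesis using True by (auto simp: \<phi>_eq intro!: cos_gt_zero_pi)
    qed (simp add: \<phi>_eq)
    show "\<phi>'' j x \<le> ((if z j then 0 else k) - \<theta>\<^sup>2) * \<phi> j x"
    proof (cases "z j")
      case False
      then show ?thesis using \<theta>(2) \<kappa>(2) by (auto simp: \<phi>_eq \<phi>''_eq intro!: mult_right_mono)
    qed (simp add: \<phi>_eq \<phi>''_eq)
  next
    fix j assume j: "Suc j < L"
    then have j': "j < L" by simp
    define t where "t = real (Suc j)"
    have shift: "t - (real j + 1/2) = 1/2" "t - (real (Suc j) + 1/2) = - (1/2)" by (simp_all add: t_def)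
    have leftwall: "t - mid j = (real (run_end z L j) - real (run_start z j)) / 2" if "z j" "\<not> z (Suc j)"
      using run_end_step[where z = z, OF j' that(1)] run_end_wall[of "Suc j" L z] that by (simp add: mid_def t_def field_simps)
    have rightwall: "t - mid (Suc j) = - ((real (run_end z L (Suc j)) - real (run_start z (Suc j))) / 2)" if "\<not> z j"
      using that by (simp add: mid_def t_def field_simps)
    have same: "mid (Suc j) = mid j" if "z j"
      using that run_end_step[where z = z, OF j' that] by (simp add: mid_def)
    have r0: "0 \<le> real (run_end z L i) - real (run_start z i)" if "i < L" for i
      using run_start_le[of z i] run_end_props(1)[of i L z] that by simp
    show "\<phi>' (Suc j) (real (Suc j)) * \<phi> j (real (Suc j)) \<le> \<phi>' j (real (Suc j)) * \<phi> (Suc j) (real (Suc j))"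
      unfolding t_def[symmetric]
    proof (cases "z j"; cases "z (Suc j)")
      assume "z j" "z (Suc j)"
      then show "\<phi>' (Suc j) t * \<phi> j t \<le> \<phi>' j t * \<phi> (Suc j) t"
        by (simp add: \<phi>_eq \<phi>'_eq same)
    next
      assume zz: "z j" "\<not> z (Suc j)"
      then show "\<phi>' (Suc j) t * \<phi> j t \<le> \<phi>' j t * \<phi> (Suc j) t"
        using core[OF r0[OF j'] rb(2)[OF j']] unfolding \<phi>_eq \<phi>'_eq shift leftwall[OF zz]
        by (simp add: mult_ac)
    next
      assume zz: "\<not> z j" "z (Suc j)"
      then show "\<phi>' (Suc j) t * \<phi> j t \<le> \<phi>' j t * \<phi> (Suc j) t"
        using core[OF r0[OF j] rb(2)[OF j]] unfolding \<phi>_eq \<phi>'_eq shift rightwall[OF zz(1)]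
        by (simp add: mult_ac)
    next
      assume "\<not> z j" "\<not> z (Suc j)"
      then show "\<phi>' (Suc j) t * \<phi> j t \<le> \<phi>' j t * \<phi> (Suc j) t"
        unfolding \<phi>_eq \<phi>'_eq shift using \<kappa> sinh0 by simp
    qed
  qed
qed

text \<open>
  The supersolution is \<open>B + (x - a) * (b - x) / 2\<close> on a run \<open>[a, b]\<close>, with the same constant
  \<open>B\<close> for all runs, and a hyperbolic cosine on each wall cell that takes the value \<open>B\<close> at both ends. The slope
  of the parabola at the ends of a run is at most \<open>l / 2\<close> in absolute value; the hyperbolic cosine is
  scaled to have the slopes \<open>- l / 2\<close> and \<open>l / 2\<close>, so all kinks are concave.
\<close>

lemma landscape_le_of_short_runs:
  assumes k: "0 < k"
    and q: "\<And>x. 0 \<le> x \<Longrightarrow> x < real L \<Longrightarrow> q x = (if z (nat \<lfloor>x\<rfloor>) then 0 else k)"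
    and l: "l = longest_run z L"
    and x: "0 < x" "x < real L"
  shows "landscape q (real L) x \<le> (real l)\<^sup>2 / 8 + (2 / k + real l * penetration k / 4)"
proof -
  have L: "0 < L" using x by (cases L) auto
  define \<kappa> where "\<kappa> = sqrt (k / 2)"
  have \<kappa>: "0 < \<kappa>" "\<kappa>\<^sup>2 = k / 2" using k by (auto simp: \<kappa>_def)
  have sinh0: "0 < sinh (\<kappa> / 2)" using \<kappa> by simp
  \<comment> \<open>The factor that gives the hyperbolic cosine the slopes \<open>- l / 2\<close> and \<open>l / 2\<close> at the ends of a
    wall cell.\<close>
  define d where "d = real l / (2 * (\<kappa> * sinh (\<kappa> / 2)))"
  have d: "0 \<le> d" "d * \<kappa> * sinh (\<kappa> / 2) = real l / 2" using \<kappa> sinh0 by (auto simp: d_def)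
  define B where "B = 2 / k + real l * penetration k / 4"
  have B: "0 \<le> B" using k penetration_pos[OF k] by (simp add: B_def)
  have Bd: "2 / k + d * cosh (\<kappa> / 2) = B"
  proof -
    have "d * cosh (\<kappa> / 2) = d * (penetration k * (\<kappa> * sinh (\<kappa> / 2))) / 2"
      using penetration_cosh[OF k] by (simp add: \<kappa>_def)
    also have "\<dots> = (d * \<kappa> * sinh (\<kappa> / 2)) * penetration k / 2" by (simp add: mult_ac)
    also have "\<dots> = real l * penetration k / 4" by (simp add: d(2))
    finally show ?thesis by (simp add: B_def)
  qed
  let ?A = "\<lambda>j. real (run_start z j)" and ?E = "\<lambda>j. real (run_end z L j)"
  define \<psi> where "\<psi> j = (if z j then (\<lambda>x. B + (x - ?A j) * (?E j - x) / 2)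
    else (\<lambda>x. 2 / k + d * cosh (\<kappa> * (x - (real j + 1/2)))))" for j
  define \<psi>' where "\<psi>' j = (if z j then (\<lambda>x. (?A j + ?E j) / 2 - x)
    else (\<lambda>x. d * \<kappa> * sinh (\<kappa> * (x - (real j + 1/2)))))" for j
  define \<psi>'' where "\<psi>'' j = (if z j then (\<lambda>x. - 1) else (\<lambda>x. d * \<kappa>\<^sup>2 * cosh (\<kappa> * (x - (real j + 1/2)))))" for j
  have \<psi>_eq: "\<psi> j x = (if z j then B + (x - ?A j) * (?E j - x) / 2
      else 2 / k + d * cosh (\<kappa> * (x - (real j + 1/2))))"
    and \<psi>'_eq: "\<psi>' j x = (if z j then (?A j + ?E j) / 2 - x
      else d * \<kappa> * sinh (\<kappa> * (x - (real j + 1/2))))"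
    and \<psi>''_eq: "\<psi>'' j x = (if z j then - 1 else d * \<kappa>\<^sup>2 * cosh (\<kappa> * (x - (real j + 1/2))))" for j x
    unfolding \<psi>_def \<psi>'_def \<psi>''_def by (simp_all only: if_distribR)
  note rb = run_bounds[where z = z and L = L, folded l]
  obtain i where i: "i < L" "x \<in> {real i..real i + 1}" using obtain_closed_cell[of x L] x L by auto
  have "landscape q (real L) x \<le> \<psi> i x"
  proof (rule landscape_le_supersolution[where c = "\<lambda>j. if z j then 0 else k" and \<psi> = \<psi> and \<psi>' = \<psi>' and \<psi>'' = \<psi>'', OF q])
    fix j x assume j: "j < L" and x: "x \<in> {real j..real j + 1}"
    have "((\<lambda>x. B + (x - ?A j) * (?E j - x) / 2) has_real_derivative (?A j + ?E j) / 2 - x) (at x within {real j..real j + 1})"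
      by (auto intro!: derivative_eq_intros simp: field_simps)
    then show "(\<psi> j has_real_derivative \<psi>' j x) (at x within {real j..real j + 1})"
      unfolding \<psi>_def \<psi>'_def using DERIV_cosh_affine(1) by (cases "z j"; simp only: if_True if_False)
    have "((\<lambda>x. (?A j + ?E j) / 2 - x) has_real_derivative - 1) (at x within {real j..real j + 1})"
      by (auto intro!: derivative_eq_intros)
    then show "(\<psi>' j has_real_derivative \<psi>'' j x) (at x within {real j..real j + 1})"
      unfolding \<psi>'_def \<psi>''_def using DERIV_cosh_affine(2) by (cases "z j"; simp only: if_True if_False)
    show "\<psi>'' j x \<le> (if z j then 0 else k) * \<psi> j x - 1"
    proof (cases "z j")
      case False
      define X where "X = d * cosh (\<kappa> * (x - (real j + 1/2)))"
      have X: "0 \<le> X" using d by (simp add: X_def)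
      have "\<psi>'' j x = k / 2 * X" using False \<kappa>(2) by (simp add: \<psi>''_eq X_def)
      moreover have "k * \<psi> j x - 1 = 1 + k * X"
        using False k by (simp add: \<psi>_eq X_def[symmetric] distrib_left)
      moreover have "k / 2 * X \<le> k * X" using X k by (intro mult_right_mono) auto
      ultimately have "\<psi>'' j x \<le> k * \<psi> j x - 1" by linarith
      then show ?thesis using False by simp
    qed (simp add: \<psi>''_eq)
  next
    fix j assume j: "Suc j < L"
    then have j': "j < L" by simp
    define t where "t = real (Suc j)"
    have shift: "t - (real j + 1/2) = 1/2" "t - (real (Suc j) + 1/2) = - (1/2)" by (simp_all add: t_def)
    have same: "?A (Suc j) = ?A j" "?E (Suc j) = ?E j" if "z j"
      using that run_end_step[where z = z, OF j' that] by simp_all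
    have lw: "?E j = t" if "z j" "\<not> z (Suc j)"
      using run_end_step[where z = z, OF j' that(1)] run_end_wall[of "Suc j" L z] that by (simp add: t_def)
    have rw: "?A (Suc j) = t" if "\<not> z j" using that by (simp add: t_def)
    have wall: "2 / k + d * cosh (\<kappa> * (1/2)) = B" "2 / k + d * cosh (\<kappa> * - (1/2)) = B"
      "d * \<kappa> * sinh (\<kappa> * (1/2)) = real l / 2" "d * \<kappa> * sinh (\<kappa> * - (1/2)) = - (real l / 2)"
      using Bd d(2) by simp_all
    show "\<psi> (Suc j) (real (Suc j)) = \<psi> j (real (Suc j))"
      unfolding t_def[symmetric] \<psi>_eq shift wall using same lw rw Bd
      by (cases "z j"; cases "z (Suc j)"; simp)
    have left: "\<psi>' j t = (if z j then (?A j + ?E j) / 2 - t else real l / 2)"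
      using wall(3) shift(1) by (simp only: \<psi>'_eq)
    have right: "\<psi>' (Suc j) t = (if z (Suc j) then (?A (Suc j) + ?E (Suc j)) / 2 - t else - (real l / 2))"
      using wall(4) shift(2) by (simp only: \<psi>'_eq)
    have "\<psi>' (Suc j) t \<le> \<psi>' j t"
    proof (cases "z j"; cases "z (Suc j)")
      assume "z j" "\<not> z (Suc j)"
      with lw rb(2)[OF j'] show ?thesis by (simp add: left right)
    next
      assume "\<not> z j" "z (Suc j)"
      with rw rb(2)[OF j] show ?thesis by (simp add: left right)
    qed (simp_all add: left right same)
    then show "\<psi>' (Suc j) (real (Suc j)) \<le> \<psi>' j (real (Suc j))" by (simp only: t_def)
  next
    show "0 \<le> \<psi> 0 0" using B d k by (auto simp: \<psi>_eq)
    have "?E (L - 1) = real L" if "z (L - 1)"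
      using run_end_step[of "L - 1" L z] run_end_wall[of L L z] that L by simp
    then show "0 \<le> \<psi> (L - 1) (real L)" using B d k by (auto simp: \<psi>_eq)
  qed (use k i in auto)
  also have "\<psi> i x \<le> (real l)\<^sup>2 / 8 + B"
  proof (cases "z i")
    case True
    define r where "r = ?E i - ?A i"
    have "0 \<le> r" "r \<le> real l" using rb(2)[OF i(1)] rb(1)[OF i(1)] rb(3)[OF i(1) True] by (auto simp: r_def)
    then have "r\<^sup>2 \<le> (real l)\<^sup>2" by (intro power_mono)
    moreover have "(x - ?A i) * (?E i - x) = r\<^sup>2 / 4 - (x - (?A i + ?E i) / 2)\<^sup>2"
      by (simp add: r_def power2_eq_square field_simps)
    then have "(x - ?A i) * (?E i - x) \<le> r\<^sup>2 / 4" by simp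
    ultimately show ?thesis using True by (simp add: \<psi>_eq)
  next
    case False
    have "\<bar>x - (real i + 1/2)\<bar> \<le> 1/2" using i(2) unfolding atLeastAtMost_iff by linarith
    then have "\<bar>\<kappa>\<bar> * \<bar>x - (real i + 1/2)\<bar> \<le> \<kappa> * (1/2)"
      using \<kappa> by (intro mult_mono) auto
    then have "\<bar>\<kappa> * (x - (real i + 1/2))\<bar> \<le> \<kappa> / 2" by (simp add: abs_mult)
    then have "cosh \<bar>\<kappa> * (x - (real i + 1/2))\<bar> \<le> cosh (\<kappa> / 2)"
      using \<kappa> by (subst cosh_real_nonneg_le_iff) auto
    then have "d * cosh (\<kappa> * (x - (real i + 1/2))) \<le> d * cosh (\<kappa> / 2)"
      using d(1) by (intro mult_left_mono) auto
    then show ?thesis using False Bd by (simp add: \<psi>_eq add_increasing)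
  qed
  finally show ?thesis by (simp add: B_def)
qed

section \<open>Bounds and limits for the ratio\<close>

lemma scaled_potential_eq:
  assumes "\<And>j. j < L \<Longrightarrow> w (int j) \<in> {0, 1}" "0 \<le> x" "x < real L"
  shows "k * potential w x = (if w (int (nat \<lfloor>x\<rfloor>)) = 0 then 0 else k)"
proof -
  have "nat \<lfloor>x\<rfloor> < L" "int (nat \<lfloor>x\<rfloor>) = \<lfloor>x\<rfloor>" using assms(2,3) by linarith+
  then show ?thesis using assms(1)[of "nat \<lfloor>x\<rfloor>"] by (auto simp: potential_eq)
qed

lemma ratio_eq_at_maximum:
  assumes k: "0 < k" and L: "0 < L" and w: "\<And>j. j < L \<Longrightarrow> w (int j) \<in> {0, 1}"
  obtains x where "0 < x" "x < real L"
    "eigenvalue_landscape_ratio w k L =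
      ground_eigenvalue (\<lambda>x. k * potential w x) (real L) * landscape (\<lambda>x. k * potential w x) (real L) x"
    "0 < landscape (\<lambda>x. k * potential w x) (real L) x"
    "\<And>y. 0 < y \<Longrightarrow> y < real L \<Longrightarrow>
      landscape (\<lambda>x. k * potential w x) (real L) y \<le> landscape (\<lambda>x. k * potential w x) (real L) x"
proof -
  define q where "q x = k * potential w x" for x
  define c where "c j = (if w (int j) = 0 then 0 else k)" for j
  have q: "q x = c (nat \<lfloor>x\<rfloor>)" if "0 \<le> x" "x < real L" for x
    using scaled_potential_eq[of L w x k] w that by (simp add: q_def c_def)
  have c: "0 \<le> c j" for j using k by (simp add: c_def)
  obtain x where x: "0 < x" "x < real L" "min_inverse_landscape q (real L) = 1 / landscape q (real L) x"
    "\<And>y. 0 < y \<Longrightarrow> y < real L \<Longrightarrow> landscape q (real L) y \<le> landscape q (real L) x"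
    using min_inverse_landscape_eq[where q = q and c = c, OF q c L] by blast
  have "0 < landscape q (real L) x"
    using landscape_pos[where q = q and c = c, OF q c] x by blast
  moreover have "eigenvalue_landscape_ratio w k L = ground_eigenvalue q (real L) * landscape q (real L) x"
    using x(3) by (simp add: eigenvalue_landscape_ratio_def q_def[abs_def])
  ultimately show thesis using x(1,2,4) by (intro that[of x]) (auto simp: q_def[abs_def])
qed

text \<open>
  The minimum of the reciprocal landscape function is the reciprocal of its maximum, so the ratio is
  the product of the ground state eigenvalue, between \<open>(pi / (l + C))\<^sup>2\<close> and \<open>(pi / l)\<^sup>2\<close>, and of the
  maximum of the landscape function, between \<open>l\<^sup>2 / 8\<close> and \<open>l\<^sup>2 / 8 + (2 / k + l * C / 4)\<close>.
\<close>

lemma ratio_bounds: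
  assumes k: "0 < k" and w: "\<And>j. j < L \<Longrightarrow> w (int j) \<in> {0, 1}"
    and l: "l = longest_run (\<lambda>j. w (int j) = 0) L" "0 < l" and lk: "(pi / real l)\<^sup>2 \<le> k / 2"
  shows "pi\<^sup>2 / 8 * (real l / (real l + penetration k))\<^sup>2 \<le> eigenvalue_landscape_ratio w k L"
    and "eigenvalue_landscape_ratio w k L
      \<le> pi\<^sup>2 / 8 + pi\<^sup>2 * (2 / k + real l * penetration k / 4) / (real l)\<^sup>2"
proof -
  define z where "z j \<longleftrightarrow> w (int j) = 0" for j
  define q where "q x = k * potential w x" for x
  define c where "c j = (if z j then 0 else k)" for j
  define C where "C = penetration k"
  have C: "0 < C" using penetration_pos[OF k] by (simp add: C_def)
  have lz: "l = longest_run z L" using l(1) by (simp add: z_def[abs_def])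
  have q: "q x = c (nat \<lfloor>x\<rfloor>)" if "0 \<le> x" "x < real L" for x
    using scaled_potential_eq[of L w x k] w that by (simp add: q_def c_def z_def)
  have c: "0 \<le> c j" for j using k by (simp add: c_def)
  obtain a b where ab: "a \<le> b" "b \<le> L" "\<forall>i\<in>{a..<b}. z i" "l = b - a"
    using longest_run_attained[of L z] lz by auto
  have ab': "a < b" "real b - real a = real l" using ab l(2) by auto
  have L: "0 < L" using ab ab' by simp
  have well: "c j = 0" if "a \<le> j" "j < b" for j using ab(3) that by (simp add: c_def)
  define \<mu>0 where "\<mu>0 = ground_eigenvalue q (real L)"
  have eig: "dirichlet_eigenvalue q (real L) \<mu>0" and upper: "\<mu>0 \<le> (pi / real l)\<^sup>2"
    using ground_eigenvalue_le_of_well[where q = q and c = c and d = 0, OF q c ab'(1) ab(2) well] ab'(2)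
    by (simp_all add: \<mu>0_def)
  define \<theta> where "\<theta> = pi / (real l + C)"
  have \<theta>: "0 < \<theta>" "\<theta> \<le> pi / real l" using C l(2) by (auto simp: \<theta>_def intro!: divide_left_mono)
  then have "\<theta>\<^sup>2 \<le> (pi / real l)\<^sup>2" by (intro power_mono) auto
  with lk have \<theta>k: "\<theta>\<^sup>2 \<le> k / 2" by simp
  have lower: "\<theta>\<^sup>2 \<le> \<mu>0"
  proof (rule ccontr)
    assume "\<not> \<theta>\<^sup>2 \<le> \<mu>0"
    then have "0 < shoot c \<mu>0 (real L)"
      unfolding c_def by (intro shoot_pos_of_short_runs[OF k L lz _ \<theta>k]) (auto simp: \<theta>_def C_def)
    moreover have "shoot c \<mu>0 (real L) = 0"
      using eig dirichlet_eigenvalue_iff_shoot[where q = q and c = c, OF L q] by blast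
    ultimately show False by simp
  qed
  obtain x where x: "0 < x" "x < real L"
    "eigenvalue_landscape_ratio w k L = \<mu>0 * landscape q (real L) x" "0 < landscape q (real L) x"
    "\<And>y. 0 < y \<Longrightarrow> y < real L \<Longrightarrow> landscape q (real L) y \<le> landscape q (real L) x"
    using ratio_eq_at_maximum[OF k L, of w] w unfolding q_def[abs_def] \<mu>0_def by blast
  define U where "U = landscape q (real L) x"
  have U_ge: "(real l)\<^sup>2 / 8 \<le> U"
  proof -
    have "(real l)\<^sup>2 / 8 \<le> landscape q (real L) ((real a + real b) / 2)"
      using landscape_ge_of_well[where q = q and c = c, OF q c ab'(1) ab(2) well] ab'(2) by simp
    also have "\<dots> \<le> U" unfolding U_def using ab' ab by (intro x(5)) auto
    finally show ?thesis .
  qed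
  have U_le: "U \<le> (real l)\<^sup>2 / 8 + (2 / k + real l * C / 4)"
    unfolding U_def C_def
    by (rule landscape_le_of_short_runs[where z = z, OF k _ lz x(1,2)]) (simp add: q c_def)
  have "pi\<^sup>2 / 8 * (real l / (real l + C))\<^sup>2 = \<theta>\<^sup>2 * ((real l)\<^sup>2 / 8)"
    by (simp add: \<theta>_def power_divide)
  also have "\<dots> \<le> \<mu>0 * U" using lower U_ge by (intro mult_mono) (auto intro: order_trans[OF zero_le_power2])
  finally show "pi\<^sup>2 / 8 * (real l / (real l + penetration k))\<^sup>2 \<le> eigenvalue_landscape_ratio w k L"
    by (simp add: x(3) U_def C_def)
  have "\<mu>0 * U \<le> (pi / real l)\<^sup>2 * ((real l)\<^sup>2 / 8 + (2 / k + real l * C / 4))"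
    using upper U_le U_ge by (intro mult_mono) (auto intro: order_trans[OF _ U_ge])
  also have "\<dots> = pi\<^sup>2 / 8 + pi\<^sup>2 * (2 / k + real l * C / 4) / (real l)\<^sup>2"
    using l(2) by (simp add: power_divide distrib_left add_divide_distrib mult.commute)
  finally show "eigenvalue_landscape_ratio w k L
      \<le> pi\<^sup>2 / 8 + pi\<^sup>2 * (2 / k + real l * penetration k / 4) / (real l)\<^sup>2"
    by (simp add: x(3) U_def C_def)
qed

text \<open>
  The potential is the constant \<open>k\<close>: the ground state eigenvalue is at most \<open>k + (pi / L)\<^sup>2\<close>, and
  the constant \<open>1 / k\<close> is a supersolution of the landscape equation.
\<close>

lemma ratio_le_without_zeros:
  assumes k: "0 < k" and L: "0 < L" and w: "\<And>j. j < L \<Longrightarrow> w (int j) = 1"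
  shows "eigenvalue_landscape_ratio w k L \<le> 1 + (pi / real L)\<^sup>2 / k"
proof -
  define q where "q x = k * potential w x" for x
  have q: "q x = (\<lambda>_. k) (nat \<lfloor>x\<rfloor>)" if "0 \<le> x" "x < real L" for x
  proof -
    have "nat \<lfloor>x\<rfloor> < L" "int (nat \<lfloor>x\<rfloor>) = \<lfloor>x\<rfloor>" using that by linarith+
    then show ?thesis using w[of "nat \<lfloor>x\<rfloor>"] by (simp add: q_def potential_eq)
  qed
  have w01: "w (int j) \<in> {0, 1}" if "j < L" for j using w[OF that] by simp
  have k0: "0 \<le> (\<lambda>_. k) j" for j :: nat using k by simp
  have upper: "ground_eigenvalue q (real L) \<le> k + (pi / real L)\<^sup>2"
    using ground_eigenvalue_le_of_well(2)[where q = q and c = "\<lambda>_. k" and d = k, OF q k0 L order_refl] by simp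
  obtain x where x: "0 < x" "x < real L"
    "eigenvalue_landscape_ratio w k L = ground_eigenvalue q (real L) * landscape q (real L) x"
    "0 < landscape q (real L) x"
    using ratio_eq_at_maximum[where w = w, OF k L w01] unfolding q_def[abs_def] by metis
  obtain i where i: "i < L" "x \<in> {real i..real i + 1}" using obtain_closed_cell[of x L] x L by auto
  have "landscape q (real L) x \<le> (\<lambda>_ _. 1 / k) i x"
    by (rule landscape_le_supersolution[where q = q and c = "\<lambda>_. k" and \<psi> = "\<lambda>_ _. 1 / k" and \<psi>' = "\<lambda>_ _. 0"
        and \<psi>'' = "\<lambda>_ _. 0", OF q k0]) (use k i in auto)
  then have "ground_eigenvalue q (real L) * landscape q (real L) x \<le> (k + (pi / real L)\<^sup>2) * (1 / k)"
    using upper x(4) k by (intro mult_mono) auto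
  also have "\<dots> = 1 + (pi / real L)\<^sup>2 / k" using k by (simp add: field_simps)
  finally show ?thesis by (simp only: x(3))
qed

lemma ratio_tendsto_large_domain:
  assumes k: "0 < k" and w: "\<And>j. w (int j) \<in> {0, 1}"
    and runs: "filterlim (longest_run (\<lambda>j. w (int j) = 0)) at_top sequentially"
  shows "(\<lambda>L. eigenvalue_landscape_ratio w k L) \<longlonglongrightarrow> pi\<^sup>2 / 8"
proof -
  define l where "l L = real (longest_run (\<lambda>j. w (int j) = 0) L)" for L
  define C where "C = penetration k"
  have lim: "filterlim l at_top sequentially"
    unfolding l_def[abs_def] by (rule filterlim_compose[OF filterlim_real_sequentially runs])
  have inv: "(\<lambda>L. A / l L) \<longlonglongrightarrow> 0" for A
    by (rule tendsto_divide_0[OF tendsto_const filterlim_at_top_imp_at_infinity[OF lim]])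
  have ev: "\<forall>\<^sub>F L in sequentially. 0 < l L \<and> (pi / l L)\<^sup>2 \<le> k / 2"
  proof -
    have "(\<lambda>L. (pi / l L)\<^sup>2) \<longlonglongrightarrow> 0\<^sup>2" by (intro tendsto_power inv)
    then have "\<forall>\<^sub>F L in sequentially. (pi / l L)\<^sup>2 < k / 2" by (rule order_tendstoD) (use k in simp)
    moreover have "\<forall>\<^sub>F L in sequentially. 0 < l L" using lim by (simp add: filterlim_at_top_dense)
    ultimately show ?thesis by eventually_elim simp
  qed
  show ?thesis
  proof (rule tendsto_sandwich)
    show "\<forall>\<^sub>F L in sequentially. pi\<^sup>2 / 8 * (1 / (1 + C / l L))\<^sup>2 \<le> eigenvalue_landscape_ratio w k L"
      using ev
    proof eventually_elim
      case (elim L)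
      then have "1 / (1 + C / l L) = l L / (l L + C)" by (simp add: field_simps)
      with ratio_bounds(1)[where k = k and w = w and L = L, OF k w refl] elim show ?case
        by (simp add: l_def C_def)
    qed
    show "\<forall>\<^sub>F L in sequentially. eigenvalue_landscape_ratio w k L
        \<le> pi\<^sup>2 / 8 + pi\<^sup>2 * (2 / k * (1 / l L)\<^sup>2 + C / 4 / l L)"
      using ev
    proof eventually_elim
      case (elim L)
      then have "pi\<^sup>2 * (2 / k * (1 / l L)\<^sup>2 + C / 4 / l L) = pi\<^sup>2 * (2 / k + l L * C / 4) / (l L)\<^sup>2"
        by (simp add: power2_eq_square add_divide_distrib distrib_left)
      with ratio_bounds(2)[where k = k and w = w and L = L, OF k w refl] elim show ?case
        by (simp add: l_def C_def)
    qed
    have "(\<lambda>L. pi\<^sup>2 / 8 * (1 / (1 + C / l L))\<^sup>2) \<longlonglongrightarrow> pi\<^sup>2 / 8 * (1 / (1 + 0))\<^sup>2"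
      by (intro tendsto_intros inv) simp
    then show "(\<lambda>L. pi\<^sup>2 / 8 * (1 / (1 + C / l L))\<^sup>2) \<longlonglongrightarrow> pi\<^sup>2 / 8" by simp
    have "(\<lambda>L. pi\<^sup>2 / 8 + pi\<^sup>2 * (2 / k * (1 / l L)\<^sup>2 + C / 4 / l L)) \<longlonglongrightarrow> pi\<^sup>2 / 8 + pi\<^sup>2 * (2 / k * 0\<^sup>2 + 0)"
      by (intro tendsto_add tendsto_mult tendsto_power tendsto_const inv)
    then show "(\<lambda>L. pi\<^sup>2 / 8 + pi\<^sup>2 * (2 / k * (1 / l L)\<^sup>2 + C / 4 / l L)) \<longlonglongrightarrow> pi\<^sup>2 / 8" by simp
  qed
qed

lemma ratio_tendsto_strong_coupling:
  assumes w: "\<And>j. j < L \<Longrightarrow> w (int j) \<in> {0, 1}" and j: "j < L" "w (int j) = 0"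
  shows "((\<lambda>k. eigenvalue_landscape_ratio w k L) \<longlongrightarrow> pi\<^sup>2 / 8) at_top"
proof -
  define l where "l = longest_run (\<lambda>j. w (int j) = 0) L"
  have "Suc j - j \<le> l" unfolding l_def by (rule longest_run_ge) (use j in \<open>auto simp: less_Suc_eq_le dest: le_antisym\<close>)
  then have l: "0 < l" by simp
  have ev: "\<forall>\<^sub>F k in at_top. 0 < k \<and> (pi / real l)\<^sup>2 \<le> k / 2"
    using eventually_gt_at_top[of 0] eventually_ge_at_top[of "2 * (pi / real l)\<^sup>2"] by eventually_elim simp
  show ?thesis
  proof (rule tendsto_sandwich)
    show "\<forall>\<^sub>F k in at_top. pi\<^sup>2 / 8 * (real l / (real l + penetration k))\<^sup>2 \<le> eigenvalue_landscape_ratio w k L"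
      using ev by eventually_elim (use ratio_bounds(1)[where w = w and L = L, OF _ w l_def l] in blast)
    show "\<forall>\<^sub>F k in at_top. eigenvalue_landscape_ratio w k L
        \<le> pi\<^sup>2 / 8 + pi\<^sup>2 * (2 / k + real l * penetration k / 4) / (real l)\<^sup>2"
      using ev by eventually_elim (use ratio_bounds(2)[where w = w and L = L, OF _ w l_def l] in blast)
    have "((\<lambda>k. pi\<^sup>2 / 8 * (real l / (real l + penetration k))\<^sup>2) \<longlongrightarrow> pi\<^sup>2 / 8 * (real l / (real l + 0))\<^sup>2) at_top"
      using l by (intro tendsto_intros tendsto_penetration) simp
    then show "((\<lambda>k. pi\<^sup>2 / 8 * (real l / (real l + penetration k))\<^sup>2) \<longlongrightarrow> pi\<^sup>2 / 8) at_top"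
      using l by simp
    have "((\<lambda>k. 2 / k) \<longlongrightarrow> (0::real)) at_top"
      by (rule tendsto_divide_0[OF tendsto_const filterlim_at_top_imp_at_infinity[OF filterlim_ident]])
    then have "((\<lambda>k. pi\<^sup>2 / 8 + pi\<^sup>2 * (2 / k + real l * penetration k / 4) / (real l)\<^sup>2)
        \<longlongrightarrow> pi\<^sup>2 / 8 + pi\<^sup>2 * (0 + real l * 0 / 4) / (real l)\<^sup>2) at_top"
      using l by (intro tendsto_add tendsto_mult tendsto_divide tendsto_const tendsto_penetration) simp_all
    then show "((\<lambda>k. pi\<^sup>2 / 8 + pi\<^sup>2 * (2 / k + real l * penetration k / 4) / (real l)\<^sup>2) \<longlongrightarrow> pi\<^sup>2 / 8) at_top"
      by simp
  qed
qed

lemma ratio_not_tendsto_without_zeros: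
  assumes L: "0 < L" and w: "\<And>j. j < L \<Longrightarrow> w (int j) = 1"
  shows "\<not> ((\<lambda>k. eigenvalue_landscape_ratio w k L) \<longlongrightarrow> pi\<^sup>2 / 8) at_top"
proof
  assume lim: "((\<lambda>k. eigenvalue_landscape_ratio w k L) \<longlongrightarrow> pi\<^sup>2 / 8) at_top"
  have "((\<lambda>k. (pi / real L)\<^sup>2 / k) \<longlongrightarrow> (0::real)) at_top"
    by (rule tendsto_divide_0[OF tendsto_const filterlim_at_top_imp_at_infinity[OF filterlim_ident]])
  then have lim1: "((\<lambda>k. 1 + (pi / real L)\<^sup>2 / k) \<longlongrightarrow> 1 + (0::real)) at_top"
    by (intro tendsto_add tendsto_const)
  have "pi\<^sup>2 / 8 \<le> 1 + 0"
    by (rule tendsto_le[OF trivial_limit_at_top_linorder lim1 lim])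
      (use eventually_gt_at_top[of 0] in \<open>eventually_elim, use ratio_le_without_zeros[where w = w, OF _ L w] in blast\<close>)
  moreover have "3\<^sup>2 < pi\<^sup>2" using pi_gt3 by (intro power_strict_mono) auto
  ultimately show False by simp
qed

section \<open>Long runs of zeros in a Bernoulli sequence\<close>

lemma (in prob_space) prob_all_in_block:
  fixes X :: "int \<Rightarrow> 'a \<Rightarrow> real"
  assumes ind: "indep_vars (\<lambda>_. borel) X UNIV" and A: "A \<in> sets borel"
    and pr: "\<And>j. prob {s \<in> space M. X j s \<in> A} = r"
  shows "prob {s \<in> space M. \<forall>j\<in>{a..<a + n}. X (int j) s \<in> A} = r ^ n"
proof (cases "n = 0")
  case False
  let ?J = "int ` {a..<a + n}"
  have "{s \<in> space M. \<forall>j\<in>{a..<a + n}. X (int j) s \<in> A} = (\<Inter>j\<in>?J. X j -` A \<inter> space M)"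
    using False by auto
  moreover have "prob (\<Inter>j\<in>?J. X j -` A \<inter> space M) = (\<Prod>j\<in>?J. prob (X j -` A \<inter> space M))"
    by (rule indep_varsD[OF ind]) (use False A in auto)
  moreover have "X j -` A \<inter> space M = {s \<in> space M. X j s \<in> A}" for j by auto
  ultimately show ?thesis by (simp add: pr card_image)
qed (simp add: prob_space)

text \<open>
  The disjoint blocks \<open>{i * n..<i * n + n}\<close> are independent, and each of them consists of zeros with the
  positive probability \<open>p ^ n\<close>. So with probability one this happens for at least one block.
\<close>

lemma (in prob_space) AE_block_of_zeros:
  fixes X :: "int \<Rightarrow> 'a \<Rightarrow> real"
  assumes ind: "indep_vars (\<lambda>_. borel) X UNIV" and p: "0 < p"
    and pr: "\<And>j. prob {s \<in> space M. X j s = 0} = p"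
  shows "AE s in M. \<exists>a. \<forall>j\<in>{a..<a + n}. X (int j) s = 0"
proof (cases "n = 0")
  case False
  have [measurable]: "X j \<in> borel_measurable M" for j
    using ind by (auto simp: indep_vars_def)
  define r where "r = 1 - p ^ n"
  define G where "G i = {s \<in> space M. \<forall>j\<in>{i * n..<i * n + n}. X (int j) s = 0}" for i
  have G[measurable]: "G i \<in> events" for i unfolding G_def by measurable
  have "prob (G i) = p ^ n" for i
    using prob_all_in_block[OF ind, of "{0}" p "i * n" n] pr by (simp add: G_def)
  then have bad: "prob (space M - G i) = r" for i by (simp add: prob_compl r_def)
  have r: "0 \<le> r" "r < 1" using bad[of 0] measure_nonneg[of M "space M - G 0"] p by (auto simp: r_def)
  define K where "K i = int ` {i * n..<i * n + n}" for i
  have disj: "disjoint_family_on K UNIV"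
    unfolding disjoint_family_on_def
  proof (intro ballI impI)
    fix a b :: nat assume "a \<noteq> b"
    have div: "x div n = i" if "x \<in> {i * n..<i * n + n}" for x i
      using that by (intro div_nat_eqI) (auto simp: mult.commute)
    show "K a \<inter> K b = {}"
    proof (rule ccontr)
      assume "K a \<inter> K b \<noteq> {}"
      then obtain x y where "x \<in> {a * n..<a * n + n}" "y \<in> {b * n..<b * n + n}" "int x = int y"
        unfolding K_def by blast
      then have "a = b" using div by (metis of_nat_eq_iff)
      with \<open>a \<noteq> b\<close> show False by simp
    qed
  qed
  define Y where "Y i s = restrict (\<lambda>j. X j s) (K i)" for i s
  have indY: "indep_vars (\<lambda>i. PiM (K i) (\<lambda>_. borel)) Y UNIV"
    unfolding Y_def[abs_def] using disj by (intro indep_vars_restrict[OF ind]) auto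
  define B where "B i = {f \<in> space (PiM (K i) (\<lambda>_. borel :: real measure)). \<exists>j\<in>K i. f j \<noteq> 0}" for i
  have B: "B i \<in> sets (PiM (K i) (\<lambda>_. borel))" for i
  proof -
    have "finite (K i)" by (simp add: K_def)
    then show ?thesis unfolding B_def by measurable
  qed
  have YB: "Y i -` B i \<inter> space M = space M - G i" for i
    by (auto simp: Y_def B_def G_def K_def space_PiM)
  have none: "prob (\<Inter>i<Suc N. space M - G i) = r ^ Suc N" for N
    using indep_varsD[OF indY, of "{..<Suc N}" B] B by (simp add: YB bad lessThan_empty_iff)
  define Bad where "Bad = {s \<in> space M. \<forall>i. s \<notin> G i}"
  have [measurable]: "Bad \<in> events" unfolding Bad_def by measurable
  have "prob Bad \<le> r ^ Suc N" for N
    unfolding none[symmetric] by (rule finite_measure_mono) (auto simp: Bad_def)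
  moreover have "(\<lambda>N. r ^ Suc N) \<longlonglongrightarrow> 0"
    using r by (intro LIMSEQ_Suc LIMSEQ_power_zero) auto
  ultimately have "prob Bad \<le> 0" by (intro LIMSEQ_le_const[of _ 0]) auto
  then have "prob Bad = 0" by (simp add: measure_le_0_iff)
  then have "AE s in M. s \<notin> Bad" using prob_eq_0[of Bad] by simp
  then show ?thesis
    using AE_space by eventually_elim (auto simp: Bad_def G_def)
qed simp

lemma longest_run_at_top:
  assumes "\<And>n. \<exists>a. \<forall>j\<in>{a..<a + n}. z j"
  shows "filterlim (longest_run z) at_top sequentially"
  unfolding filterlim_at_top
proof
  fix n
  obtain a where a: "\<forall>j\<in>{a..<a + n}. z j" using assms by blast
  have "n \<le> longest_run z L" if "a + n \<le> L" for L
    using longest_run_ge[of a "a + n" L z] a that by simp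
  then show "\<forall>\<^sub>F L in sequentially. n \<le> longest_run z L"
    using eventually_ge_at_top[of "a + n"] by (rule eventually_mono[rotated]) 
qed

theorem corollary3:
  fixes M :: "'a measure" and X :: "int \<Rightarrow> 'a \<Rightarrow> real" and p :: real
  assumes "prob_space M"
    and "prob_space.indep_vars M (\<lambda>_. borel) X UNIV"
    and "0 < p" and "p < 1"
    and "\<And>j. measure M {s \<in> space M. X j s = 0} = p"
    and "\<And>j. measure M {s \<in> space M. X j s = 1} = 1 - p"
  shows "(\<forall>k::real. k > 0 \<longrightarrow>
            (AE s in M. (\<lambda>L. eigenvalue_landscape_ratio (\<lambda>j. X j s) k L) \<longlonglongrightarrow> pi\<^sup>2 / 8)) \<and>
         (\<forall>L::nat. L > 0 \<longrightarrow>
            (let E = {s \<in> space M.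
                 ((\<lambda>k. eigenvalue_landscape_ratio (\<lambda>j. X j s) k L) \<longlongrightarrow> pi\<^sup>2 / 8) at_top}
             in E \<in> sets (completion M) \<and> measure (completion M) E = 1 - (1 - p) ^ L))"
proof -
  interpret prob_space M by (rule assms(1))
  note ind = assms(2)
  have [measurable]: "X j \<in> borel_measurable M" for j
    using ind by (auto simp: indep_vars_def)
  have AE01: "AE s in M. \<forall>j. X j s \<in> {0, 1}"
    unfolding AE_all_countable
  proof
    fix j
    have "prob ({s \<in> space M. X j s = 0} \<union> {s \<in> space M. X j s = 1}) =
        prob {s \<in> space M. X j s = 0} + prob {s \<in> space M. X j s = 1}"
      by (rule finite_measure_Union) auto
    also have "\<dots> = 1" by (simp add: assms(5,6)[of j])
    finally have "prob ({s \<in> space M. X j s = 0} \<union> {s \<in> space M. X j s = 1}) = 1" .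
    moreover have "{s \<in> space M. X j s = 0} \<union> {s \<in> space M. X j s = 1} = {s \<in> space M. X j s \<in> {0, 1}}"
      by auto
    ultimately have "prob {s \<in> space M. X j s \<in> {0, 1}} = 1" by simp
    then show "AE s in M. X j s \<in> {0, 1}" by (subst (asm) prob_Collect_eq_1) auto
  qed
  have "AE s in M. \<forall>n. \<exists>a. \<forall>j\<in>{a..<a + n}. X (int j) s = 0"
    unfolding AE_all_countable using AE_block_of_zeros[OF ind assms(3,5)] by blast
  with AE01 have large: "AE s in M. (\<lambda>L. eigenvalue_landscape_ratio (\<lambda>j. X j s) k L) \<longlonglongrightarrow> pi\<^sup>2 / 8"
    if "0 < k" for k
  proof eventually_elim
    case (elim s)
    show ?case
    proof (rule ratio_tendsto_large_domain[OF that])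
      show "X (int j) s \<in> {0, 1}" for j using elim(1) by blast
      show "filterlim (longest_run (\<lambda>j. X (int j) s = 0)) at_top sequentially"
        by (rule longest_run_at_top) (use elim(2) in blast)
    qed
  qed
  have coupling: "E \<in> sets (completion M) \<and> measure (completion M) E = 1 - (1 - p) ^ L"
    if L: "0 < L" and E: "E = {s \<in> space M.
      ((\<lambda>k. eigenvalue_landscape_ratio (\<lambda>j. X j s) k L) \<longlongrightarrow> pi\<^sup>2 / 8) at_top}" for L E
  proof -
    define F where "F = {s \<in> space M. \<exists>j<L. X (int j) s = 0}"
    have [measurable]: "F \<in> events" unfolding F_def by measurable
    have EF: "AE s in M. s \<in> E \<longleftrightarrow> s \<in> F"
      using AE01 AE_space
    proof eventually_elim
      case (elim s)
      show ?case
      proof (cases "\<exists>j<L. X (int j) s = 0")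
        case True
        then show ?thesis
          using ratio_tendsto_strong_coupling[of L "\<lambda>j. X j s"] elim by (auto simp: E F_def)
      next
        case False
        with elim(1) have "X (int j) s = 1" if "j < L" for j using that by blast
        then show ?thesis
          using ratio_not_tendsto_without_zeros[OF L, of "\<lambda>j. X j s"] False by (auto simp: E F_def)
      qed
    qed
    \<comment> \<open>Measurability of \<open>E\<close> is only known up to a null set, hence the completion.\<close>
    then obtain N where N: "{s \<in> space M. \<not> (s \<in> E \<longleftrightarrow> s \<in> F)} \<subseteq> N" "N \<in> null_sets M"
      unfolding eventually_ae_filter by blast
    have "E = (F - N) \<union> (E \<inter> N)" using N(1) by (auto simp: E F_def)
    moreover have "F - N \<in> sets M" using N(2) by auto
    ultimately have Es: "E \<in> sets (completion M)" using N(2) by (intro sets_completionI[of _ _ _ N]) auto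
    have "measure (completion M) E = measure (completion M) F"
      using Es by (intro measure_eq_AE AE_completion EF) auto
    also have "\<dots> = prob F" by simp
    also have "F = space M - {s \<in> space M. \<forall>j\<in>{0..<0 + L}. X (int j) s \<in> - {0}}"
      by (auto simp: F_def)
    also have "prob \<dots> = 1 - prob {s \<in> space M. \<forall>j\<in>{0..<0 + L}. X (int j) s \<in> - {0}}"
      by (rule prob_compl) measurable
    also have "prob {s \<in> space M. \<forall>j\<in>{0..<0 + L}. X (int j) s \<in> - {0}} = (1 - p) ^ L"
    proof (rule prob_all_in_block[OF ind])
      fix j
      have "{s \<in> space M. X j s \<in> - {0}} = space M - {s \<in> space M. X j s = 0}" by auto
      then show "prob {s \<in> space M. X j s \<in> - {0}} = 1 - p"
        using prob_compl[of "{s \<in> space M. X j s = 0}"] assms(5) by simp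
    qed auto
    finally show ?thesis using Es by simp
  qed
  show ?thesis using large coupling by (simp add: Let_def)
qed

end
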